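(* Let $K$ be a sufficiently large (fixed) positive constant, let $\delta>0$ be suitably small, let $N^{1/2+\delta}\le Q\le N$, and let $Q_0$ be a real number such that $$K\sqrt{N\log N}\le Q\le N\quad\text{and}\quad \frac{N\log N}{Q}\le Q_0\le \frac{Q}{K^2}.$$ Let $\mathfrak{m}=\mathfrak{m}(K,Q_0,Q)$ be the corresponding set of minor arcs. Assume that $KQ_0\le N^{1/2-\delta}(\log N)^{17}$. Let $u:=(\log N)/(\log y)$. There exists a large constant $C>0$ such that the following holds. If $$1+\frac{\log C}{\log N}\le u\le 2$$ and $N$ is large enough in terms of $\delta$, we have $$\int_{\mathfrak{m}}|\mathcal{S}_{\mathbf{1}_{y\text{-smooth}}}(\theta)|^2\,d\theta\gg_\delta N\log u+Q .$$
   Context: The major arcs $\mathfrak{M}=\mathfrak{M}(K,Q_0,Q)$ consist of those $\theta\in\mathbb{R}/\mathbb{Z}$ for which there are a positive integer $q\le KQ_0$ and a reduced residue class $a$ modulo $q$ (i.e. $(a,q)=1$) with $|\theta-a/q|\le K/(qQ)$. The minor arcs $\mathfrak{m}=\mathfrak{m}(K,Q_0,Q)$ are the complement of $\mathfrak{M}$ in $\mathbb{R}/\mathbb{Z}$. For an arithmetic function $f$, $\mathcal{S}_f(\theta):=\sum_{n\le N}f(n)e(n\theta)$ with $e(t)=e^{2\pi i t}$. $\mathbf{1}_{y\text{-smooth}}$ is the indicator function of the positive integers all of whose prime factors $p$ satisfy $p\le y$. $A\gg_\delta B$ means $A\ge \kappa B$ for a constant $\kappa>0$ depending on $\delta$ (and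 possibly on the fixed constant $K$). *)

theory Defs
  imports "HOL-Analysis.Analysis" "HOL-Computational_Algebra.Primes"
begin

text \<open>
  Subsets of \<open>\<real>/\<int>\<close> are given by their representatives. The major arcs are the full
  (1-periodic) preimage in \<open>\<real>\<close>: letting \<open>a\<close> run over all integers coprime to \<open>q\<close>,
  rather than over one representative of each class, expresses the distance in \<open>\<real>/\<int>\<close>.
  The minor arcs are the complement inside the fundamental domain \<open>[0,1)\<close>, so that
  Lebesgue measure on them is the Haar probability measure of \<open>\<real>/\<int>\<close>.
\<close>

definition major_arcs :: "real \<Rightarrow> real \<Rightarrow> real \<Rightarrow> real set" where
  "major_arcs K Q\<^sub>0 Q =
     {\<theta>. \<exists>(q::nat) (a::int). 0 < q \<and> real q \<le> K * Q\<^sub>0 \<and> coprime a (int q) \<and>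
          \<bar>\<theta> - real_of_int a / real q\<bar> \<le> K / (real q * Q)}"

definition minor_arcs :: "real \<Rightarrow> real \<Rightarrow> real \<Rightarrow> real set" where
  "minor_arcs K Q\<^sub>0 Q = {0..<1} - major_arcs K Q\<^sub>0 Q"

definition additive_char :: "real \<Rightarrow> complex" where
  "additive_char t = exp (2 * complex_of_real pi * \<i> * complex_of_real t)"

definition exp_sum :: "(nat \<Rightarrow> complex) \<Rightarrow> nat \<Rightarrow> real \<Rightarrow> complex" where
  "exp_sum f N \<theta> = (\<Sum>n=1..N. f n * additive_char (real n * \<theta>))"

definition smooth_numbers :: "real \<Rightarrow> nat set" where
  "smooth_numbers y = {n. 0 < n \<and> (\<forall>p. prime p \<and> p dvd n \<longrightarrow> real p \<le> y)}"

end

theory Submission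
  imports Defs "HOL-Real_Asymp.Real_Asymp" "HOL-Number_Theory.Totient" "HOL-Computational_Algebra.Squarefree"
begin

text \<open>
  Write \<open>M = N / y\<close>. Every non-smooth \<open>n \<le> N\<close> is \<open>m p\<close> with a unique prime \<open>p > y\<close> and \<open>m < M\<close>.
  Take \<open>q = r l\<close> with \<open>r\<close> squarefree and free of primes \<open>\<le> M\<close>, and \<open>l\<close> prime,
  of size \<open>N powr (1/2 - \<delta>/2) < q \<le> N powr (1/2 - \<delta>/4)\<close>. Summed over the reduced fractions with
  denominator \<open>q\<close>, the exponential sum becomes a sum of Ramanujan sums, and on the non-smooth numbers
  \<open>c\<^sub>r(n) = \<plusminus>1\<close> has constant sign while \<open>c\<^sub>l(n) = -1\<close> unless \<open>l\<close> divides \<open>m\<close>. There is thus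
  no cancellation, and the sum has size \<open>N ln M / ln N\<close>, whereas the full sum over \<open>n \<le> N\<close> is
  negligible. By Cauchy-Schwarz the disjoint arcs of radius \<open>1/(4096 N)\<close> around these fractions, all
  of them minor, contribute \<open>\<gg> (N ln M / ln N)\<^sup>2 (\<Sum> 1/q) / N\<close>. Mertens' theorem gives
  \<open>\<Sum> 1/l \<gg> \<delta>\<close> and \<open>\<Sum> 1/r \<gg> ln N / ln M\<close>, hence the term \<open>N ln u\<close>.

  The term \<open>Q\<close> comes from \<open>[2K/Q, 3K/Q]\<close>, where the full sum is a Dirichlet kernel and, by
  Parseval, the non-smooth part costs at most \<open>O(N ln M / ln N)\<close>, which the first bound absorbs.
\<close>

section \<open>Mertens' first theorem\<close>

text \<open>The difficulty is that \<open>M\<close> runs from a constant up to about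
  \<open>N powr (1/2)\<close>. For large \<open>M\<close>, a modulus made only of primes above
  \<open>M\<close> need not exist in the required range. For small \<open>M\<close>, a single prime
  modulus is too weak: Cauchy-Schwarz yields the square of the density \<open>ln M / ln N\<close> of
  the non-smooth numbers. The shape \<open>r l\<close> serves both ends. The prime \<open>l\<close>
  may be smaller than \<open>M\<close> and tunes the size of the modulus; the sum over
  \<open>r\<close>, of order \<open>ln N / ln M\<close>, cancels one factor of the density. Once
  \<open>M\<close> exceeds \<open>N powr (1/8)\<close>, only \<open>r = 1\<close> is left. The range
  of \<open>q\<close> is pinned from both sides. It must lie above \<open>K * Q\<^sub>0\<close>, so
  that no major arc is centred at \<open>a/q\<close>; half of \<delta> is spent there on the power
  of \<open>ln N\<close>. It must keep \<open>q ^ 2\<close> well below \<open>N / ln N\<close>,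
  because the full sum can contribute \<open>2 * q ^ 2\<close>. The lower bound on \<open>u\<close>
  makes \<open>ln M\<close> exceed a multiple of the error in Mertens' theorem; otherwise
  \<open>(y, N]\<close> could be too short for that theorem to produce primes in it.\<close>

lemma prod_primes_dvd:
  fixes n :: nat
  assumes "finite A" "\<And>p. p \<in> A \<Longrightarrow> prime p \<and> p dvd n"
  shows "\<Prod>A dvd n"
  using assms
proof (induction A rule: finite_induct)
  case (insert p A)
  have "coprime p (\<Prod>A)"
    using insert by (intro prod_coprime_right primes_coprime) auto
  then show ?case
    using insert by (simp add: divides_mult)
qed simp

lemma finite_primes_le [simp]: "finite {p::nat. prime p \<and> p \<le> n}"
  by (rule finite_subset[of _ "{..n}"]) auto

text \<open>Induction after Erdos: the primes in \<open>(m + 1, 2 * m + 1]\<close> all divide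
  \<open>2 * m + 1 choose m\<close>, which is at most \<open>4 ^ m\<close>, and an even
  \<open>n > 2\<close> adds no prime. The bound pays for replacing \<open>n div p\<close> by
  \<open>n / p\<close> in Mertens' theorem.\<close>

lemma chebyshev_theta_le: "(\<Sum>p | prime p \<and> p \<le> n. ln (real p)) \<le> real n * ln 4"
proof (induction n rule: less_induct)
  case (less n)
  let ?P = "\<lambda>n. {p::nat. prime p \<and> p \<le> n}"
  have fin [simp]: "finite (?P k)" for k
    by simp
  consider "n \<le> 1" | "n = 2" | m where "n = 2 * m" "m \<ge> 2" | m where "n = 2 * m + 1" "m \<ge> 1"
  proof -
    have "n \<le> 1 \<or> n = 2 \<or> n = 2 * (n div 2) \<and> n div 2 \<ge> 2
      \<or> n = 2 * (n div 2) + 1 \<and> n div 2 \<ge> 1" by presburger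
    then show ?thesis using that(1,2) that(3)[of "n div 2"] that(4)[of "n div 2"] by argo
  qed
  then show ?case
  proof cases
    case 1
    then have "?P n = {}" by (auto dest: prime_ge_2_nat)
    then show ?thesis by (simp only: sum.empty) simp
  next
    case 2
    have "?P 2 = {2}" using prime_ge_2_nat by (auto intro: antisym)
    moreover have "ln (2::real) \<le> 2 * ln 4" by (simp add: ln_realpow[of 2 2, simplified])
    ultimately show ?thesis using 2 by simp
  next
    case 3
    have "0 < ln (4::real)" by simp
    have "\<not> prime n" using 3 primes_dvd_imp_eq[OF two_is_prime_nat, of n] by auto
    then have "?P n = ?P (n - 1)"
      using 3 by (auto simp: le_eq_less_or_eq)
    then show ?thesis
      using order_trans[OF less[of "n - 1"] mult_right_mono[of "real (n - 1)" "real n" "ln 4"]] 3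
      by simp
  next
    case 4
    let ?A = "{p. prime p \<and> m + 1 < p \<and> p \<le> 2 * m + 1}"
    have finA [simp]: "finite ?A" by (rule finite_subset[of _ "{..2*m+1}"]) auto
    have split: "?P n = ?P (m + 1) \<union> ?A" using 4 by auto
    have "\<Prod>?A dvd (2 * m + 1 choose m)"
    proof (rule prod_primes_dvd)
      fix p assume p: "p \<in> ?A"
      have "fact m * fact (2 * m + 1 - m) * (2 * m + 1 choose m) = (fact (2 * m + 1) :: nat)"
        by (rule binomial_fact_lemma) simp
      moreover have "p dvd fact (2 * m + 1)" "\<not> p dvd fact m" "\<not> p dvd (fact (2 * m + 1 - m) :: nat)"
        using p by (subst prime_dvd_fact_iff; simp)+
      ultimately show "prime p \<and> p dvd (2 * m + 1 choose m)"
        using p prime_dvd_multD[of p "fact m * fact (2 * m + 1 - m)" "2 * m + 1 choose m"]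
          prime_dvd_multD[of p "fact m" "fact (2 * m + 1 - m)"]
        by (metis mem_Collect_eq)
    qed simp
    then have "\<Prod>?A \<le> (2 * m + 1 choose m)" by (intro dvd_imp_le) auto
    also have "\<dots> \<le> 4 ^ m"
    proof -
      \<comment> \<open>The two middle entries of the row are equal, so each is at most half of the
        row sum.\<close>
      have "(2 * m + 1 choose m) + (2 * m + 1 choose (m + 1)) = (\<Sum>k\<in>{m, m+1}. 2 * m + 1 choose k)"
        by simp
      also have "\<dots> \<le> (\<Sum>k\<le>2 * m + 1. 2 * m + 1 choose k)"
        by (rule sum_mono2) auto
      also have "\<dots> = 2 ^ (2 * m + 1)" by (rule choose_row_sum)
      also have "\<dots> = 2 * 4 ^ m" by (simp add: power_mult)
      finally show ?thesis
        using binomial_symmetric[of m "2 * m + 1"] by (simp del: binomial_Suc_Suc)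
    qed
    finally have "real (\<Prod>?A) \<le> real (4 ^ m)" unfolding of_nat_le_iff .
    then have "(\<Prod>p\<in>?A. real p) \<le> 4 ^ m" by simp
    moreover have pos: "\<And>p. p \<in> ?A \<Longrightarrow> 0 < p" using prime_gt_0_nat by auto
    ultimately have "ln (\<Prod>p\<in>?A. real p) \<le> ln (4 ^ m)"
      by (subst ln_le_cancel_iff) (auto intro!: prod_pos simp: prime_gt_0_nat)
    moreover have "ln (\<Prod>p\<in>?A. real p) = (\<Sum>p\<in>?A. ln (real p))"
      by (rule ln_prod) (auto simp: prime_gt_0_nat)
    ultimately have "(\<Sum>p\<in>?A. ln (real p)) \<le> real m * ln 4" by (simp add: ln_realpow)
    moreover have "(\<Sum>p\<in>?P (m+1). ln (real p)) \<le> real (m + 1) * ln 4"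
      using less[of "m + 1"] 4 by simp
    moreover have "(\<Sum>p\<in>?P n. ln (real p)) = (\<Sum>p\<in>?P (m+1). ln (real p)) + (\<Sum>p\<in>?A. ln (real p))"
      unfolding split by (rule sum.union_disjoint) auto
    ultimately show ?thesis using 4 by (simp add: algebra_simps)
  qed
qed

section \<open>Legendre's formula and Mertens' theorem for integers\<close>

lemma card_multiples: "d > 0 \<Longrightarrow> card {k \<in> {1..n}. d dvd k} = n div (d::nat)"
proof -
  assume d: "d > 0"
  have "{k \<in> {1..n}. d dvd k} = (*) d ` {1..n div d}"
  proof (intro equalityI subsetI)
    fix k assume k: "k \<in> {k \<in> {1..n}. d dvd k}"
    then obtain j where "k = d * j" by auto
    then show "k \<in> (*) d ` {1..n div d}"
      using k d by (auto simp: less_eq_div_iff_mult_less_eq mult.commute)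
  next
    fix k assume "k \<in> (*) d ` {1..n div d}"
    then show "k \<in> {k \<in> {1..n}. d dvd k}"
      using d by (auto simp: less_eq_div_iff_mult_less_eq mult.commute)
  qed
  then show ?thesis using d by (simp add: card_image inj_on_def)
qed

lemma multiplicity_eq_card:
  assumes "prime p" "0 < k" "k \<le> (n::nat)"
  shows "multiplicity p k = card {j \<in> {1..n}. p ^ j dvd k}"
proof -
  have *: "p ^ j dvd k \<longleftrightarrow> j \<le> multiplicity p k" for j
    using assms by (intro power_dvd_iff_le_multiplicity) auto
  have "j < n" if "p ^ j dvd k" for j
  proof -
    have "j < p ^ j" using assms prime_gt_1_nat by (intro power_gt_expt) auto
    also have "\<dots> \<le> k" using that assms by (intro dvd_imp_le) auto
    finally show ?thesis using assms by simp
  qed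
  then have "{j \<in> {1..n}. p ^ j dvd k} = {1..multiplicity p k}"
    unfolding * by force
  then show ?thesis by simp
qed

lemma ln_eq_sum_multiplicity:
  assumes "0 < k" "k \<le> n"
  shows "ln (real k) = (\<Sum>p | prime p \<and> p \<le> n. real (multiplicity p k) * ln (real p))"
proof -
  have "real k = (\<Prod>p\<in>prime_factors k. real p ^ multiplicity p k)"
    using arg_cong[OF prime_factorization_nat[of k], of real] assms by simp
  then have "ln (real k) = (\<Sum>p\<in>prime_factors k. ln (real p ^ multiplicity p k))"
    using ln_prod[of "prime_factors k" "\<lambda>p. real p ^ multiplicity p k"]
    by (simp add: in_prime_factors_iff prime_gt_0_nat)
  also have "\<dots> = (\<Sum>p\<in>prime_factors k. real (multiplicity p k) * ln (real p))"
    by (intro sum.cong) (auto simp: ln_realpow in_prime_factors_iff prime_gt_0_nat)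
  also have "\<dots> = (\<Sum>p | prime p \<and> p \<le> n. real (multiplicity p k) * ln (real p))"
  proof (rule sum.mono_neutral_left)
    show "prime_factors k \<subseteq> {p. prime p \<and> p \<le> n}"
      using assms by (auto simp: in_prime_factors_iff dest!: dvd_imp_le)
    show "\<forall>i\<in>{p. prime p \<and> p \<le> n} - prime_factors k. real (multiplicity i k) * ln (real i) = 0"
      using assms by (auto simp: in_prime_factors_iff not_dvd_imp_multiplicity_0)
  qed simp
  finally show ?thesis .
qed

text \<open>Logarithmic form of Legendre's formula for \<open>n!\<close>. Exponents up to
  \<open>n\<close> suffice, since \<open>p ^ j\<close> exceeds \<open>n\<close> beyond them.\<close>

lemma sum_ln_eq_sum_primes:
  "(\<Sum>k=1..n. ln (real k)) =
     (\<Sum>p | prime p \<and> p \<le> n. ln (real p) * real (\<Sum>j=1..n. n div p ^ j))"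
proof -
  have "(\<Sum>k=1..n. ln (real k)) =
      (\<Sum>k=1..n. \<Sum>p | prime p \<and> p \<le> n. real (multiplicity p k) * ln (real p))"
    by (intro sum.cong refl ln_eq_sum_multiplicity) auto
  also have "\<dots> = (\<Sum>p | prime p \<and> p \<le> n. \<Sum>k=1..n. real (multiplicity p k) * ln (real p))"
    by (rule sum.swap)
  also have "\<dots> = (\<Sum>p | prime p \<and> p \<le> n. ln (real p) * real (\<Sum>j=1..n. n div p ^ j))"
  proof (intro sum.cong refl)
    fix p assume "p \<in> {p. prime p \<and> p \<le> n}"
    then have p: "prime p" "p > 0" by (auto simp: prime_gt_0_nat)
    have "(\<Sum>k=1..n. multiplicity p k) = (\<Sum>k=1..n. \<Sum>j=1..n. if p ^ j dvd k then 1 else 0)"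
      using p by (intro sum.cong refl)
        (simp add: multiplicity_eq_card[where n=n] card_eq_sum sum.inter_filter[symmetric] del: sum_constant)
    also have "\<dots> = (\<Sum>j=1..n. \<Sum>k=1..n. if p ^ j dvd k then 1 else 0)" by (rule sum.swap)
    also have "\<dots> = (\<Sum>j=1..n. n div p ^ j)"
      using p by (intro sum.cong refl)
        (simp add: card_multiples[symmetric] card_eq_sum sum.inter_filter[symmetric] del: sum_constant)
    finally show "(\<Sum>k=1..n. real (multiplicity p k) * ln (real p)) = ln (real p) * real (\<Sum>j=1..n. n div p ^ j)"
      by (simp only: sum_distrib_right[symmetric] of_nat_sum[symmetric] mult.commute[of "ln (real p)"])
  qed
  finally show ?thesis .
qed

text \<open>Weak Stirling bound; the induction step is
  \<open>n * ln (1 + 1 / n) \<le> 1\<close>.\<close>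

lemma sum_ln_ge: "n > 0 \<Longrightarrow> (\<Sum>k=1..n. ln (real k)) \<ge> real n * ln (real n) - real n"
proof (induction n)
  case (Suc n)
  show ?case
  proof (cases "n = 0")
    case False
    have "real n * (ln (real (Suc n)) - ln (real n)) \<le> 1"
    proof -
      have "ln (real (Suc n)) - ln (real n) = ln (1 + 1 / real n)"
        using False by (simp add: ln_divide_pos[symmetric] field_simps)
      also have "\<dots> \<le> 1 / real n" by (rule ln_add_one_self_le_self) auto
      finally show ?thesis using False by (simp add: field_simps)
    qed
    then show ?thesis using Suc False by (simp add: algebra_simps)
  qed simp
qed simp

text \<open>The geometric series is split into \<open>1 / p\<close>, the source of the main term of
  Mertens' theorem, and the tail \<open>1 / (p * (p - 1))\<close>, which is summable against
  \<open>ln p\<close>.\<close>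

lemma sum_prime_powers_le:
  assumes "p \<ge> 2"
  shows "real (\<Sum>j=1..n. n div p ^ j) \<le> real n * (1 / real p + 1 / (real p * (real p - 1)))"
proof -
  have "real (\<Sum>j=1..n. n div p ^ j) \<le> (\<Sum>j=1..n. real n * (1 / real p) ^ j)"
    unfolding of_nat_sum
    by (intro sum_mono) (auto simp: power_divide intro: order_trans[OF of_nat_div_le_of_nat])
  also have "\<dots> = real n * (\<Sum>j=1..n. (1 / real p) ^ j)" by (simp add: sum_distrib_left)
  also have "(\<Sum>j=1..n. (1 / real p) ^ j) \<le> 1 / (real p - 1)"
  proof (induction n)
    case 0 then show ?case using assms by simp
  next
    case (Suc n)
    have eq: "(\<Sum>j=1..n. (1 / real p) ^ j) = (1 - (1 / real p) ^ n) / (real p - 1)" for n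
    proof (induction n)
      case (Suc n)
      have "(\<Sum>j=1..Suc n. (1 / real p) ^ j) = (\<Sum>j=1..n. (1 / real p) ^ j) + (1 / real p) ^ n * (1 / real p)"
        by simp
      then show ?case
        unfolding Suc using assms by (simp only: power_Suc) (simp add: divide_simps, simp add: algebra_simps)
    qed simp
    show ?case unfolding eq using assms by (intro divide_right_mono) auto
  qed
  also have "1 / (real p - 1) = 1 / real p + 1 / (real p * (real p - 1))"
    using assms by (simp add: field_simps)
  finally show ?thesis by (simp add: mult_left_mono)
qed

lemma sum_ln_prime_correction_bounded:
  "\<exists>B. \<forall>n. (\<Sum>p | prime p \<and> p \<le> n. ln (real p) / (real p * (real p - 1))) \<le> B"
proof -
  have "summable (\<lambda>n. ln (real n) / (real n * (real n - 1)))"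
  proof (rule summable_comparison_test_bigo)
    show "summable (\<lambda>n. norm (real n powr (-3/2)))"
      by (simp add: summable_real_powr_iff)
    show "(\<lambda>n. ln (real n) / (real n * (real n - 1))) \<in> O(\<lambda>n. real n powr (-3/2))"
      by real_asymp
  qed
  then have "(\<Sum>p | prime p \<and> p \<le> n. ln (real p) / (real p * (real p - 1)))
      \<le> (\<Sum>n. ln (real n) / (real n * (real n - 1)))" for n
  proof (rule sum_le_suminf)
    fix m :: nat
    \<comment> \<open>At \<open>m = 0\<close> and \<open>m = 1\<close> the denominator vanishes and
      the quotient is 0 by convention.\<close>
    show "ln (real m) / (real m * (real m - 1)) \<ge> 0" by (cases "m = 0") auto
  qed simp
  then show ?thesis by blast
qed

text \<open>Two estimates of \<open>ln n!\<close>. From above it is at most \<open>n * ln n\<close>;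
  keeping only \<open>j = 1\<close> and dropping the floors costs at most \<open>n * ln 4\<close> by
  Chebyshev. From below it is Stirling's bound, with \<open>B\<close> paying for the higher prime
  powers.\<close>

theorem mertens_first:
  "\<exists>E>0. \<forall>n>0. \<bar>(\<Sum>p | prime p \<and> p \<le> n. ln (real p) / real p) - ln (real n)\<bar> \<le> E"
proof -
  obtain B where B: "\<forall>n. (\<Sum>p | prime p \<and> p \<le> n. ln (real p) / (real p * (real p - 1))) \<le> B"
    using sum_ln_prime_correction_bounded by blast
  have up: "(\<Sum>p | prime p \<and> p \<le> n. ln (real p) / real p) \<le> ln (real n) + ln 4" if "n > 0" for n
  proof -
    have "real n * (\<Sum>p | prime p \<and> p \<le> n. ln (real p) / real p) - (\<Sum>p | prime p \<and> p \<le> n. ln (real p))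
       = (\<Sum>p | prime p \<and> p \<le> n. ln (real p) * (real n / real p - 1))"
      by (simp add: sum_distrib_left sum_subtractf algebra_simps)
    also have "\<dots> \<le> (\<Sum>p | prime p \<and> p \<le> n. ln (real p) * real (\<Sum>j=1..n. n div p ^ j))"
    proof (intro sum_mono mult_left_mono)
      fix p assume "p \<in> {p. prime p \<and> p \<le> n}"
      then have p: "p > 0" by (auto simp: prime_gt_0_nat)
      have "real n \<le> real (n div p * p + p)"
        using dividend_less_div_times[of p n] p by (intro of_nat_mono) auto
      then have "real n / real p - 1 \<le> real (n div p)"
        using p by (simp add: field_simps)
      also have "\<dots> \<le> real (\<Sum>j=1..n. n div p ^ j)"
        using that member_le_sum[of 1 "{1..n}" "\<lambda>j. n div p ^ j"] by (intro of_nat_mono) auto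
      finally show "real n / real p - 1 \<le> real (\<Sum>j=1..n. n div p ^ j)" .
      show "0 \<le> ln (real p)" using p by simp
    qed
    also have "\<dots> = (\<Sum>k=1..n. ln (real k))" by (rule sum_ln_eq_sum_primes[symmetric])
    also have "\<dots> \<le> (\<Sum>k=1..n. ln (real n))" by (intro sum_mono) auto
    also have "\<dots> = real n * ln (real n)" by simp
    finally have "real n * (\<Sum>p | prime p \<and> p \<le> n. ln (real p) / real p) \<le> real n * (ln (real n) + ln 4)"
      using chebyshev_theta_le[of n] by (simp add: algebra_simps)
    then show ?thesis using that by simp
  qed
  have lo: "(\<Sum>p | prime p \<and> p \<le> n. ln (real p) / real p) \<ge> ln (real n) - 1 - B" if "n > 0" for n
  proof -
    have "real n * ln (real n) - real n \<le> (\<Sum>k=1..n. ln (real k))" using sum_ln_ge that by blast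
    also have "\<dots> = (\<Sum>p | prime p \<and> p \<le> n. ln (real p) * real (\<Sum>j=1..n. n div p ^ j))"
      by (rule sum_ln_eq_sum_primes)
    also have "\<dots> \<le> (\<Sum>p | prime p \<and> p \<le> n. ln (real p) * (real n * (1 / real p + 1 / (real p * (real p - 1)))))"
      by (intro sum_mono mult_left_mono sum_prime_powers_le) (auto simp: prime_ge_2_nat Suc_le_eq prime_gt_0_nat)
    also have "\<dots> = real n * ((\<Sum>p | prime p \<and> p \<le> n. ln (real p) / real p)
         + (\<Sum>p | prime p \<and> p \<le> n. ln (real p) / (real p * (real p - 1))))"
      by (simp add: sum_distrib_left sum.distrib algebra_simps)
    also have "\<dots> \<le> real n * ((\<Sum>p | prime p \<and> p \<le> n. ln (real p) / real p) + B)"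
      by (intro mult_left_mono add_left_mono B[rule_format]) auto
    finally have "real n * (ln (real n) - 1) \<le> real n * ((\<Sum>p | prime p \<and> p \<le> n. ln (real p) / real p) + B)"
      by (simp add: algebra_simps)
    then show ?thesis using that unfolding mult_le_cancel_left by simp
  qed
  define E where "E = ln 4 + \<bar>1 + B\<bar>"
  have "ln (4::real) > 0" by simp
  then have E: "E > 0" "E \<ge> ln 4" "E \<ge> 1 + B"
    unfolding E_def by linarith+
  have "\<bar>(\<Sum>p | prime p \<and> p \<le> n. ln (real p) / real p) - ln (real n)\<bar> \<le> E" if "n > 0" for n
    using up[OF that] lo[OF that] E(2,3) unfolding abs_le_iff by argo
  then show ?thesis using E(1) by (intro exI[of _ E]) simp
qed

lemma finite_primes_real [simp]: "finite {p::nat. prime p \<and> a < real p \<and> real p \<le> b}"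
  by (rule finite_subset[of _ "{..nat \<lfloor>b\<rfloor>}"]) (auto simp: le_nat_floor)

lemma finite_primes_real_le [simp]: "finite {p::nat. prime p \<and> real p \<le> b}"
  by (rule finite_subset[of _ "{..nat \<lfloor>b\<rfloor>}"]) (auto simp: le_nat_floor)

text \<open>The later ranges of primes have real endpoints. Rounding \<open>x\<close> down to
  \<open>n\<close> changes the logarithm by at most \<open>ln 2\<close>, as
  \<open>x < n + 1 \<le> 2 * n\<close>; the two endpoints account for the factor 2.\<close>

lemma mertens_interval:
  "\<exists>E>0. \<forall>a b. 1 \<le> a \<and> a \<le> b \<longrightarrow>
     \<bar>(\<Sum>p | prime p \<and> a < real p \<and> real p \<le> b. ln (real p) / real p) - ln (b / a)\<bar> \<le> E"
proof -
  obtain E where E: "E > 0" and mert: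
    "\<forall>n>0. \<bar>(\<Sum>p | prime p \<and> p \<le> n. ln (real p) / real p) - ln (real n)\<bar> \<le> E"
    using mertens_first by blast
  let ?S = "\<lambda>x::real. \<Sum>p | prime p \<and> real p \<le> x. ln (real p) / real p"
  have S: "\<bar>?S x - ln x\<bar> \<le> E + ln 2" if "x \<ge> 1" for x
  proof -
    define n where "n = nat \<lfloor>x\<rfloor>"
    have n: "n > 0" "real n \<le> x" "x < real n + 1" using that unfolding n_def by linarith+
    have "{p. prime p \<and> real p \<le> x} = {p. prime p \<and> p \<le> n}"
    proof (intro Collect_cong conj_cong refl)
      fix p :: nat
      show "real p \<le> x \<longleftrightarrow> p \<le> n" using n by linarith
    qed
    then have "\<bar>?S x - ln (real n)\<bar> \<le> E" using mert n(1) by simp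
    moreover have "ln (real n) \<le> ln x" using n by simp
    moreover have "ln x \<le> ln (real n * 2)" using n that by (subst ln_le_cancel_iff) linarith+
    moreover have "ln (real n * 2) = ln (real n) + ln 2" using n by (simp add: ln_mult)
    ultimately show ?thesis by linarith
  qed
  have "\<bar>(\<Sum>p | prime p \<and> a < real p \<and> real p \<le> b. ln (real p) / real p) - ln (b / a)\<bar>
      \<le> 2 * (E + ln 2)" if "1 \<le> a" "a \<le> b" for a b :: real
  proof -
    have "{p. prime p \<and> real p \<le> b} = {p. prime p \<and> real p \<le> a} \<union> {p. prime p \<and> a < real p \<and> real p \<le> b}"
      using that by auto
    then have "?S b = ?S a + (\<Sum>p | prime p \<and> a < real p \<and> real p \<le> b. ln (real p) / real p)"
      by (simp only:) (rule sum.union_disjoint, auto)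
    moreover have "ln (b / a) = ln b - ln a" using that by (simp add: ln_div)
    moreover have "\<bar>?S a - ln a\<bar> \<le> E + ln 2" "\<bar>?S b - ln b\<bar> \<le> E + ln 2"
      using S that by simp_all
    moreover have "\<bar>s - l\<bar> \<le> 2 * c" if "s2 = s1 + s" "l = lb - la" "\<bar>s1 - la\<bar> \<le> c" "\<bar>s2 - lb\<bar> \<le> c"
      for s s1 s2 l la lb c :: real
      using that by linarith
    ultimately show ?thesis by meson
  qed
  moreover have "2 * (E + ln 2) > 0" using E by (simp add: add_pos_pos)
  ultimately show ?thesis by meson
qed

text \<open>Replacing \<open>ln p\<close> by its value at an end of the range stands in for partial
  summation. Only a constant factor is lost in the applications, where \<open>ln p\<close> is
  comparable to \<open>ln N\<close> throughout.\<close>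

lemma sum_inverse_primes_ge:
  assumes "1 < b" "\<And>p. p \<in> A \<Longrightarrow> prime p \<and> real p \<le> b"
  shows "(\<Sum>p\<in>A. 1 / real p) \<ge> (\<Sum>p\<in>A. ln (real p) / real p) / ln b"
  unfolding sum_divide_distrib
proof (rule sum_mono)
  fix p assume "p \<in> A"
  then have "real p > 0" "ln (real p) \<le> ln b" using assms prime_gt_0_nat by auto
  then show "ln (real p) / real p / ln b \<le> 1 / real p"
    using assms by (simp add: field_simps)
qed

lemma sum_inverse_primes_le:
  assumes "1 < a" "\<And>p. p \<in> A \<Longrightarrow> prime p \<and> a < real p"
  shows "(\<Sum>p\<in>A. 1 / real p) \<le> (\<Sum>p\<in>A. ln (real p) / real p) / ln a"
  unfolding sum_divide_distrib
proof (rule sum_mono)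
  fix p assume "p \<in> A"
  then have "real p > 0" "ln a \<le> ln (real p)" using assms prime_gt_0_nat less_imp_le by auto
  then show "ln (real p) / real p / ln a \<ge> 1 / real p"
    using assms by (simp add: field_simps)
qed

section \<open>Reciprocals of squarefree rough numbers\<close>

text \<open>Telescoping in place of an integral: \<open>ln (1 - 1/x) \<le> - 1/x\<close> gives
  \<open>x powr (-1 - t) \<le> ((x - 1) powr (-t) - x powr (-t)) / t\<close>. The induction
  therefore carries the sharper bound with \<open>1 - n powr (-t)\<close>.\<close>

lemma sum_powr_le:
  assumes "t > 0" "n \<ge> 1"
  shows "(\<Sum>k=1..n. real k powr (- 1 - t)) \<le> 1 + 1 / t"
proof -
  have "(\<Sum>k=1..n. real k powr (- 1 - t)) \<le> 1 + (1 - real n powr (- t)) / t"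
    using assms(2)
  proof (induction n rule: dec_induct)
    case (step n)
    have n: "n \<ge> 1" using step by simp
    define x where "x = real (Suc n)"
    have x: "x > 1" "real n = x * (1 - 1 / x)" using n by (simp_all add: x_def right_diff_distrib)
    have "1 - 1 / x > 0" using n x(1) by (simp add: x_def)
    have "t / x \<le> t * - ln (1 - 1 / x)"
      using mult_left_mono[OF ln_le_minus_one[OF \<open>1 - 1 / x > 0\<close>], of t] assms(1) by simp
    then have "1 + t / x \<le> exp (- t * ln (1 - 1 / x))"
      using exp_ge_add_one_self[of "- t * ln (1 - 1 / x)"] by simp
    also have "\<dots> = (1 - 1 / x) powr (- t)"
      using less_imp_neq[OF \<open>1 - 1 / x > 0\<close>, symmetric] by (simp only: powr_def if_False)
    finally have "x powr (- t) * (1 + t / x) \<le> x powr (- t) * (1 - 1 / x) powr (- t)"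
      by (intro mult_left_mono) auto
    also have "\<dots> = (x * (1 - 1 / x)) powr (- t)"
      by (rule powr_mult[symmetric])
    also have "\<dots> = real n powr (- t)" by (simp only: x(2))
    also have "x powr (- t) * (1 + t / x) = x powr (- t) + t * (x powr (- t) / x)"
      by (simp add: algebra_simps)
    also have "x powr (- t) / x = x powr (- 1 - t)"
      using x powr_diff[of x "- t" 1] by (simp add: minus_diff_commute)
    finally have "x powr (- t) + t * x powr (- 1 - t) \<le> real n powr (- t)" .
    then have "x powr (- 1 - t) \<le> (real n powr (- t) - x powr (- t)) / t"
      using assms(1) by (simp add: field_simps)
    then show ?case using step.IH n
      by (simp add: x_def diff_divide_distrib)
  qed simp
  also have "\<dots> \<le> 1 + 1 / t" using assms by (intro add_left_mono divide_right_mono) auto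
  finally show ?thesis .
qed

lemma prime_factors_prod_primes:
  assumes "finite X" "\<And>p. p \<in> X \<Longrightarrow> prime (p::nat)"
  shows "prime_factors (\<Prod>X) = X"
proof -
  have "0 \<notin> X" using assms(2) not_prime_0 by blast
  then have "prime_factors (\<Prod>X) = (\<Union>p\<in>X. prime_factors p)"
    using assms(1) prime_factors_prod[of X "\<lambda>p. p"] by simp
  also have "\<dots> = (\<Union>p\<in>X. {p})"
    using assms(2) by (intro SUP_cong refl) (simp add: prime_prime_factors)
  finally show ?thesis by simp
qed

text \<open>Expanding the product gives one term for each subset of \<open>P\<close>. The
  corresponding products of primes are distinct integers by unique factorisation, so the expansion
  is part of a truncated zeta sum at \<open>1 + t\<close>.\<close>

lemma euler_product_le:
  assumes "finite P" "\<And>p. p \<in> P \<Longrightarrow> prime (p::nat)" "t > 0"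
  shows "(\<Prod>p\<in>P. 1 + real p powr (- 1 - t)) \<le> 1 + 1 / t"
proof -
  have pos: "\<Prod>X \<ge> 1" if "X \<subseteq> P" for X
  proof (rule prod_ge_1)
    fix p assume "p \<in> X"
    then show "1 \<le> p" using assms(2)[of p] that prime_ge_1_nat by blast
  qed
  have inj: "inj_on (\<lambda>X. \<Prod>X) (Pow P)"
  proof (rule inj_onI)
    fix X Z assume XZ: "X \<in> Pow P" "Z \<in> Pow P" "\<Prod>X = \<Prod>Z"
    have "prime_factors (\<Prod>A) = A" if "A \<in> Pow P" for A
      using that finite_subset[of A P] assms(1,2) by (intro prime_factors_prod_primes) blast+
    from this[OF XZ(1), symmetric] this[OF XZ(2)] show "X = Z" unfolding XZ(3) by (rule trans)
  qed
  have "(\<Prod>p\<in>P. real p powr (- 1 - t) + 1) = (\<Sum>X\<in>Pow P. \<Prod>p\<in>X. real p powr (- 1 - t))"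
    by (simp only: prod_add[OF assms(1)] prod.neutral_const mult_1_right)
  also have "\<dots> = (\<Sum>X\<in>Pow P. real (\<Prod>X) powr (- 1 - t))"
    by (simp only: of_nat_prod prod_powr_distrib)
  also have "\<dots> = (\<Sum>k\<in>(\<lambda>X. \<Prod>X) ` Pow P. real k powr (- 1 - t))"
    by (simp only: sum.reindex[OF inj] o_def)
  also have "\<dots> \<le> (\<Sum>k=1..\<Prod>P. real k powr (- 1 - t))"
  proof (rule sum_mono2)
    show "(\<lambda>X. \<Prod>X) ` Pow P \<subseteq> {1..\<Prod>P}"
    proof
      fix k assume "k \<in> (\<lambda>X. \<Prod>X) ` Pow P"
      then obtain X where X: "X \<subseteq> P" "k = \<Prod>X" by auto
      then have "k dvd \<Prod>P" using assms(1) prod_dvd_prod_subset[of P X "\<lambda>p. p"] by blast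
      then have "k \<le> \<Prod>P" using pos[OF order_refl] by (intro dvd_imp_le) auto
      then show "k \<in> {1..\<Prod>P}" using pos[OF X(1)] X(2) by simp
    qed
  qed auto
  also have "\<dots> \<le> 1 + 1 / t" by (rule sum_powr_le[OF assms(3) pos[OF order_refl]])
  finally show ?thesis by (simp add: add.commute)
qed

text \<open>
  Rankin's trick: replacing \<open>1/p\<close> by \<open>p powr (-1 - t)\<close> with \<open>t = 1 / ln M\<close> costs only a bounded factor
  by Mertens' theorem, and the new product is at most \<open>1 + 1/t\<close>.
\<close>

lemma mertens_product_le:
  "\<exists>D>0. \<forall>M>0. ln M \<ge> 1 \<longrightarrow> (\<Prod>p | prime p \<and> real p \<le> M. 1 + 1 / real p) \<le> D * ln M"
proof -
  obtain E where E: "E > 0" and mert: "\<forall>a b. 1 \<le> a \<and> a \<le> b \<longrightarrow>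
     \<bar>(\<Sum>p | prime p \<and> a < real p \<and> real p \<le> b. ln (real p) / real p) - ln (b / a)\<bar> \<le> E"
    using mertens_interval by blast
  have "(\<Prod>p | prime p \<and> real p \<le> M. 1 + 1 / real p) \<le> 2 * exp (1 + E) * ln M"
    if M: "M > 0" "ln M \<ge> 1" for M
  proof -
    let ?P = "{p::nat. prime p \<and> real p \<le> M}"
    define t where "t = 1 / ln M"
    have "exp 1 \<le> M" using M by (simp add: ln_ge_iff)
    moreover have "(1::real) < exp 1" by simp
    ultimately have "M > 1" by linarith
    then have t: "t > 0" by (simp add: t_def)
    have "1 + 1 / real p \<le> (1 + real p powr (- 1 - t)) * exp (t * (ln (real p) / real p))"
      if "p \<in> ?P" for p
    proof -
      have p: "real p > 1" using that prime_gt_1_nat[of p] by simp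
      define b where "b = real p powr (- 1 - t)"
      define e where "e = t * (ln (real p) / real p)"
      have b: "b = 1 / real p * exp (- t * ln (real p))"
      proof -
        have "b = exp (- ln (real p) + - t * ln (real p))"
          using p by (simp add: b_def powr_def algebra_simps)
        then show ?thesis using p unfolding exp_add exp_minus by (simp add: field_simps)
      qed
      have "1 - t * ln (real p) \<le> exp (- t * ln (real p))"
        using exp_ge_add_one_self[of "- t * ln (real p)"] by simp
      then have "1 / real p * (1 - t * ln (real p)) \<le> b"
        unfolding b using p by (intro mult_left_mono) auto
      then have "1 / real p - b \<le> e" using p by (simp add: e_def algebra_simps)
      moreover have "b \<ge> 0" "e \<ge> 0" using p t by (auto simp: b_def e_def)
      ultimately have "1 + 1 / real p \<le> (1 + b) * (1 + e)"
        using mult_nonneg_nonneg[of b e] unfolding distrib_left distrib_right by linarith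
      also have "\<dots> \<le> (1 + b) * exp e"
        using \<open>b \<ge> 0\<close> by (intro mult_left_mono) (auto simp: exp_ge_add_one_self)
      finally show ?thesis by (simp add: b_def e_def)
    qed
    then have "(\<Prod>p\<in>?P. 1 + 1 / real p)
        \<le> (\<Prod>p\<in>?P. (1 + real p powr (- 1 - t)) * exp (t * (ln (real p) / real p)))"
      by (intro prod_mono) auto
    also have "\<dots> = (\<Prod>p\<in>?P. 1 + real p powr (- 1 - t)) * exp (t * (\<Sum>p\<in>?P. ln (real p) / real p))"
      by (simp only: prod.distrib sum_distrib_left exp_sum[OF finite_primes_real_le])
    also have "\<dots> \<le> (1 + 1 / t) * exp (1 + E)"
    proof (intro mult_mono euler_product_le)
      have "(\<Sum>p\<in>?P. ln (real p) / real p) \<le> ln M + E"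
      proof -
        have "?P = {p. prime p \<and> 1 < real p \<and> real p \<le> M}"
          using prime_gt_1_nat by fastforce
        then show ?thesis using mert[rule_format, of 1 M] \<open>M > 1\<close>
          by (simp only: abs_le_iff) auto
      qed
      then have "t * (\<Sum>p\<in>?P. ln (real p) / real p) \<le> t * (ln M + E)"
        using t by (intro mult_left_mono) auto
      also have "\<dots> = 1 + E / ln M" using M \<open>M > 1\<close> by (simp add: t_def add_divide_distrib)
      also have "E / ln M \<le> E" using M E \<open>M > 1\<close> divide_left_mono[of 1 "ln M" E] by simp
      finally show "exp (t * (\<Sum>p\<in>?P. ln (real p) / real p)) \<le> exp (1 + E)" by simp
    qed (use t in \<open>auto intro!: prod_nonneg\<close>)
    also have "\<dots> \<le> (2 * ln M) * exp (1 + E)"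
      using M by (simp add: t_def)
    finally show ?thesis by (simp add: mult_ac)
  qed
  then show ?thesis by (intro exI[of _ "2 * exp (1 + E)"]) simp
qed

section \<open>Lower bound for the reciprocal sum over rough squarefree numbers\<close>

lemma sum_inverse_squares_le: "(\<Sum>k=1..n. 1 / real k ^ 2) \<le> 2"
proof -
  have "(\<Sum>k=1..n. 1 / real k ^ 2) \<le> 2 - 1 / real n" if "n \<ge> 1" for n
    using that
  proof (induction n rule: dec_induct)
    case (step n)
    have "1 / real (Suc n) ^ 2 \<le> 1 / real n - 1 / real (Suc n)"
    proof -
      have "1 / real n - 1 / real (Suc n) = 1 / (real n * real (Suc n))"
        using step by (simp add: field_simps)
      also have "\<dots> \<ge> 1 / real (Suc n) ^ 2"
        unfolding power2_eq_square using step by (intro divide_left_mono mult_right_mono) auto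
      finally show ?thesis .
    qed
    then show ?case using step by simp
  qed simp
  from order_trans[OF this] show ?thesis by (cases "n \<ge> 1") (simp_all add: not_le)
qed

lemma ln_le_harmonic: "n \<ge> 1 \<Longrightarrow> ln (real n + 1) \<le> (\<Sum>k=1..n. 1 / real k)"
proof (induction n rule: dec_induct)
  case base show ?case using ln_le_minus_one[of 2] by simp
next
  case (step n)
  have "ln (real (Suc n) + 1) - ln (real n + 1) = ln (1 + 1 / real (Suc n))"
    by (subst ln_divide_pos[symmetric]) (auto simp: field_simps)
  also have "\<dots> \<le> 1 / real (Suc n)" by (rule ln_add_one_self_le_self) auto
  finally show ?case using step by simp
qed

lemma sum_triple_product:
  fixes a b c :: "_ \<Rightarrow> 'a :: comm_semiring_1"
  shows "(\<Sum>(x, y, z)\<in>A \<times> B \<times> C. a x * (b y * c z)) = sum a A * (sum b B * sum c C)"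
proof -
  have "(\<Sum>(x, y, z)\<in>A \<times> B \<times> C. a x * (b y * c z)) = (\<Sum>x\<in>A. \<Sum>y\<in>B. \<Sum>z\<in>C. a x * (b y * c z))"
    by (simp only: sum.cartesian_product)
  also have "\<dots> = sum a A * (sum b B * sum c C)"
    by (simp only: sum_distrib_left[symmetric] sum_distrib_right[symmetric])
  finally show ?thesis .
qed

definition rough_squarefree :: "real \<Rightarrow> real \<Rightarrow> nat set" where
  "rough_squarefree M Y = {r. 0 < r \<and> real r \<le> Y \<and> squarefree r \<and> (\<forall>p. prime p \<and> p dvd r \<longrightarrow> M < real p)}"

lemma finite_rough_squarefree [simp]: "finite (rough_squarefree M Y)"
  by (rule finite_subset[of _ "{..nat \<lfloor>Y\<rfloor>}"]) (auto simp: rough_squarefree_def le_nat_floor)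

text \<open>The three factors come from the square part, the small primes and the large primes. A
  prime \<open>q \<le> M\<close> surviving in \<open>r\<close> would also belong to
  \<open>X\<close>, and its square would divide the squarefree part.\<close>

lemma smooth_rough_decomposition:
  assumes "0 < n" "real n \<le> Y"
  shows "\<exists>k X r. n = k ^ 2 * \<Prod>X * r \<and> 1 \<le> k \<and> k \<le> n
    \<and> X \<subseteq> {p. prime p \<and> real p \<le> M} \<and> r \<in> rough_squarefree M Y"
proof -
  define P where "P = {p::nat. prime p \<and> real p \<le> M}"
  define k d where "k = square_part n" "d = squarefree_part n"
  have n: "n = d * k ^ 2" unfolding k_d_def by (rule squarefree_decompose)
  have sq: "squarefree d" unfolding k_d_def by (rule squarefree_squarefree_part)
  have pos: "d > 0" "k > 0" using assms n by (auto intro!: Nat.gr0I)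
  define X where "X = {p\<in>P. p dvd d}"
  have "finite X" unfolding X_def P_def by (rule finite_subset[OF _ finite_primes_real_le[of M]]) auto
  then have "\<Prod>X dvd d" by (rule prod_primes_dvd) (auto simp: X_def P_def)
  then obtain r where r: "d = \<Prod>X * r" by (elim dvdE)
  have "r \<in> rough_squarefree M Y"
    unfolding rough_squarefree_def
  proof (intro CollectI conjI allI impI)
    show "0 < r" using r pos by (auto intro!: Nat.gr0I)
    show "squarefree r" using squarefree_mono[of r d] sq r dvd_triv_right[of r "\<Prod>X"] by blast
    have "r dvd n" using n r by simp
    then show "real r \<le> Y" using assms by (auto dest!: dvd_imp_le)
    fix q assume q: "prime q \<and> q dvd r"
    show "M < real q"
    proof (rule ccontr)
      assume "\<not> M < real q"
      moreover have "q dvd d" using q dvd_mult[of q r "\<Prod>X"] by (subst r) blast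
      ultimately have "q \<in> X" using q unfolding X_def P_def by simp
      then have "q dvd \<Prod>X" using \<open>finite X\<close> using dvd_prodI[of X q "\<lambda>p. p"] by simp
      then have "q ^ 2 dvd d" using q by (subst r) (simp add: power2_eq_square mult_dvd_mono)
      then show False using sq q by (auto dest!: squarefreeD)
    qed
  qed
  moreover have "k \<le> n"
    using assms n by (intro dvd_imp_le) (simp_all add: power2_eq_square)
  moreover have "n = k ^ 2 * \<Prod>X * r" unfolding n by (subst r) (simp only: mult_ac)
  moreover have "X \<subseteq> {p. prime p \<and> real p \<le> M}" unfolding X_def P_def by blast
  moreover have "1 \<le> k" using pos by simp
  ultimately show ?thesis by blast
qed

text \<open>By the decomposition, the harmonic sum up to \<open>Y\<close> is at most a product of
  three sums: inverse squares (at most 2), inverses of squarefree products of primes up to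
  \<open>M\<close> (at most \<open>D * ln M\<close>), and the wanted sum. Upper bounds for the first
  two thus bound the third from below without a sieve.\<close>

theorem sum_inverse_rough_ge:
  "\<exists>c>0. \<forall>M>0. \<forall>Y. ln M \<ge> 1 \<and> Y \<ge> 1 \<longrightarrow>
     (\<Sum>r\<in>rough_squarefree M Y. 1 / real r) \<ge> c * ln Y / ln M"
proof -
  obtain D where D: "D > 0" and prod: "\<forall>M>0. ln M \<ge> 1 \<longrightarrow>
     (\<Prod>p | prime p \<and> real p \<le> M. 1 + 1 / real p) \<le> D * ln M"
    using mertens_product_le by blast
  have "(\<Sum>r\<in>rough_squarefree M Y. 1 / real r) \<ge> 1 / (2 * D) * ln Y / ln M"
    if MY: "M > 0" "ln M \<ge> 1" "Y \<ge> 1" for M Y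
  proof -
    define P where "P = {p::nat. prime p \<and> real p \<le> M}"
    have fP: "finite P" unfolding P_def by simp
    define N where "N = nat \<lfloor>Y\<rfloor>"
    have N: "N \<ge> 1" "real N \<le> Y" "Y < real N + 1" using MY unfolding N_def by linarith+
    let ?R = "rough_squarefree M Y"
    \<comment> \<open>An arbitrary choice of decomposition is enough: \<open>n\<close> is recovered
      from its triple by multiplication, so \<open>\<phi>\<close> is injective.\<close>
    define \<phi> where "\<phi> = (\<lambda>n. SOME (k, X, r). n = k ^ 2 * \<Prod>X * r \<and> k \<in> {1..N} \<and> X \<in> Pow P \<and> r \<in> ?R)"
    have \<phi>: "case \<phi> n of (k, X, r) \<Rightarrow> n = k ^ 2 * \<Prod>X * r \<and> k \<in> {1..N} \<and> X \<in> Pow P \<and> r \<in> ?R"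
      if "n \<in> {1..N}" for n
      unfolding \<phi>_def
    proof (rule someI_ex)
      show "\<exists>x. case x of (k, X, r) \<Rightarrow> n = k ^ 2 * \<Prod>X * r \<and> k \<in> {1..N} \<and> X \<in> Pow P \<and> r \<in> ?R"
      proof -
        have "0 < n" "real n \<le> Y" using that N by auto
        from smooth_rough_decomposition[OF this, of M] obtain k X r where
          "n = k ^ 2 * \<Prod>X * r" "1 \<le> k" "k \<le> n" "X \<subseteq> P" "r \<in> ?R"
          unfolding P_def by blast
        then show ?thesis using that by (intro exI[of _ "(k, X, r)"]) simp
      qed
    qed
    define g where "g = (\<lambda>(k::nat, X::nat set, r::nat). 1 / real k ^ 2 * ((\<Prod>p\<in>X. 1 / real p) * (1 / real r)))"
    have inj: "inj_on \<phi> {1..N}"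
    proof (rule inj_onI)
      fix m n assume "m \<in> {1..N}" "n \<in> {1..N}" "\<phi> m = \<phi> n"
      then show "m = n" using \<phi>[of m] \<phi>[of n] by (cases "\<phi> n") auto
    qed
    have "ln Y \<le> (\<Sum>n=1..N. 1 / real n)"
      using MY N by (intro order_trans[OF _ ln_le_harmonic[OF N(1)]]) simp
    also have "\<dots> = (\<Sum>n=1..N. g (\<phi> n))"
    proof (intro sum.cong refl)
      fix n assume "n \<in> {1..N}"
      then obtain k X r where *: "\<phi> n = (k, X, r)" "n = k ^ 2 * \<Prod>X * r"
        using \<phi>[of n] by (cases "\<phi> n") auto
      have "real n = real k ^ 2 * (\<Prod>p\<in>X. real p) * real r" by (simp add: *(2))
      then show "1 / real n = g (\<phi> n)" by (simp add: *(1) g_def prod_dividef)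
    qed
    also have "\<dots> = (\<Sum>z\<in>\<phi> ` {1..N}. g z)" using inj by (simp add: sum.reindex)
    also have "\<dots> \<le> (\<Sum>z\<in>{1..N} \<times> Pow P \<times> ?R. g z)"
    proof (rule sum_mono2)
      show "\<phi> ` {1..N} \<subseteq> {1..N} \<times> Pow P \<times> ?R"
      proof
        fix z assume "z \<in> \<phi> ` {1..N}"
        then obtain n where "n \<in> {1..N}" "z = \<phi> n" by blast
        then show "z \<in> {1..N} \<times> Pow P \<times> ?R" using \<phi>[of n] by (cases z) auto
      qed
    qed (use fP in \<open>auto simp: g_def intro!: mult_nonneg_nonneg prod_nonneg divide_nonneg_nonneg\<close>)
    also have "\<dots> = (\<Sum>k=1..N. 1 / real k ^ 2) * ((\<Sum>X\<in>Pow P. \<Prod>p\<in>X. 1 / real p) * (\<Sum>r\<in>?R. 1 / real r))"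
      unfolding g_def by (rule sum_triple_product)
    also have "(\<Sum>X\<in>Pow P. \<Prod>p\<in>X. 1 / real p) = (\<Prod>p\<in>P. 1 / real p + 1)"
      using fP by (subst prod_add) auto
    also have "\<dots> = (\<Prod>p\<in>P. 1 + 1 / real p)" by (simp add: add.commute)
    also have "(\<Sum>k=1..N. 1 / real k ^ 2) * ((\<Prod>p\<in>P. 1 + 1 / real p) * (\<Sum>r\<in>?R. 1 / real r))
        \<le> 2 * ((D * ln M) * (\<Sum>r\<in>?R. 1 / real r))"
    proof (intro mult_mono order_refl sum_inverse_squares_le mult_nonneg_nonneg prod_nonneg sum_nonneg)
      show "(\<Prod>p\<in>P. 1 + 1 / real p) \<le> D * ln M" using prod MY by (simp add: P_def)
      show "0 \<le> ln M" using MY by linarith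
    qed (use MY D in \<open>simp_all add: less_imp_le\<close>)
    finally have "ln Y \<le> 2 * (D * ln M) * (\<Sum>r\<in>?R. 1 / real r)" by (simp only: mult.assoc)
    moreover have "2 * (D * ln M) > 0" using MY D by (intro mult_pos_pos) linarith+
    ultimately have "ln Y / (2 * (D * ln M)) \<le> (\<Sum>r\<in>?R. 1 / real r)"
      by (simp only: pos_divide_le_eq mult.commute[of _ "2 * (D * ln M)"])
    then show ?thesis by simp
  qed
  then show ?thesis using D by (intro exI[of _ "1 / (2 * D)"]) auto
qed

section \<open>Ramanujan sums\<close>

lemma additive_char_cis: "additive_char t = cis (2 * pi * t)"
  unfolding additive_char_def cis_conv_exp by (simp add: mult_ac)

lemma norm_additive_char [simp]: "cmod (additive_char t) = 1"
  by (simp add: additive_char_cis)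

lemma additive_char_add: "additive_char (s + t) = additive_char s * additive_char t"
  by (simp add: additive_char_cis cis_mult algebra_simps)

lemma additive_char_of_nat [simp]: "additive_char (real n) = 1"
  using cis_multiple_2pi[of "real n"] by (simp add: additive_char_cis mult_ac)

lemma additive_char_power: "additive_char t ^ n = additive_char (real n * t)"
  by (simp add: additive_char_cis Complex.DeMoivre mult_ac)

lemma additive_char_eq_1_iff: "additive_char t = 1 \<longleftrightarrow> t \<in> \<int>"
proof -
  have "additive_char t = 1 \<longleftrightarrow> (\<exists>n::int. 2 * pi * t = of_int (2 * n) * pi)"
    unfolding additive_char_def by (subst exp_eq_1) simp
  also have "\<dots> \<longleftrightarrow> (\<exists>n::int. t = of_int n)" by auto
  also have "\<dots> \<longleftrightarrow> t \<in> \<int>" by (auto simp: Ints_def)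
  finally show ?thesis .
qed

lemma of_nat_div_in_Ints_iff: "q > 0 \<Longrightarrow> real n / real q \<in> \<int> \<longleftrightarrow> q dvd n"
  by (metis of_int_of_nat_eq of_int_div_of_int_in_Ints_iff of_nat_0_less_iff of_nat_dvd_iff
      less_irrefl of_nat_eq_0_iff zero_less_iff_neq_zero)

lemma sum_additive_char_residues:
  assumes "q > 0"
  shows "(\<Sum>j<q. additive_char (real j * (real n / real q))) = (if q dvd n then of_nat q else 0)"
proof (cases "q dvd n")
  case True
  then have "additive_char (real n / real q) = 1"
    using assms by (simp add: additive_char_eq_1_iff of_nat_div_in_Ints_iff)
  then show ?thesis using True unfolding additive_char_power[symmetric] by simp
next
  case False
  let ?x = "additive_char (real n / real q)"
  have "?x \<noteq> 1" using False assms by (simp add: additive_char_eq_1_iff of_nat_div_in_Ints_iff)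
  moreover have "?x ^ q = 1" using assms by (simp add: additive_char_power)
  ultimately have "(\<Sum>j<q. ?x ^ j) = 0" by (simp add: geometric_sum)
  then show ?thesis using False by (simp add: additive_char_power)
qed

definition ramanujan_sum :: "nat \<Rightarrow> nat \<Rightarrow> complex" where
  "ramanujan_sum q n = (\<Sum>a\<in>totatives q. additive_char (real a * (real n / real q)))"

text \<open>The residues coprime to \<open>s\<close> alone carry complete sums modulo
  \<open>p\<close>. Those divisible by \<open>p\<close> have to be separated off, and they are
  \<open>p\<close> times the reduced residues of \<open>s\<close>.\<close>

lemma totatives_prime_mult:
  assumes "prime p" "\<not> p dvd s" "s > 0"
  shows "{a \<in> {1..p * s}. coprime a s} = totatives (p * s) \<union> (*) p ` totatives s"
    and "totatives (p * s) \<inter> (*) p ` totatives s = {}"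
proof -
  have cop: "coprime p s" using assms prime_imp_coprime by blast
  have p: "p > 0" using assms prime_gt_0_nat by blast
  show "totatives (p * s) \<inter> (*) p ` totatives s = {}"
    using assms(1) by (auto simp: in_totatives_iff coprime_mult_left_iff)
  show "{a \<in> {1..p * s}. coprime a s} = totatives (p * s) \<union> (*) p ` totatives s"
  proof (intro equalityI subsetI)
    fix a assume a: "a \<in> {a \<in> {1..p * s}. coprime a s}"
    show "a \<in> totatives (p * s) \<union> (*) p ` totatives s"
    proof (cases "p dvd a")
      case True
      then obtain b where b: "a = p * b" by auto
      then have "b \<in> totatives s" using a p by (auto simp: in_totatives_iff intro: Nat.gr0I)
      then show ?thesis using b by blast
    next
      case False
      then have "coprime a p" using assms(1) prime_imp_coprime coprime_commute by blast
      then show ?thesis using a by (auto simp: in_totatives_iff)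
    qed
  next
    fix a assume "a \<in> totatives (p * s) \<union> (*) p ` totatives s"
    then show "a \<in> {a \<in> {1..p * s}. coprime a s}"
      using p cop by (auto simp: in_totatives_iff Suc_le_eq)
  qed
qed

lemma sum_coprime_residues:
  assumes "s > 0" "p > 0"
  shows "(\<Sum>a | a \<in> {1..p * s} \<and> coprime a s. f a) = (\<Sum>b\<in>totatives s. \<Sum>j<p. f (b + s * j))"
proof -
  have "(\<Sum>b\<in>totatives s. \<Sum>j<p. f (b + s * j)) = (\<Sum>(b, j)\<in>totatives s \<times> {..<p}. f (b + s * j))"
    by (simp add: sum.cartesian_product)
  also have "\<dots> = (\<Sum>a | a \<in> {1..p * s} \<and> coprime a s. f a)"
  \<comment> \<open>Reduced residues are represented in \<open>{1..s}\<close> rather than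
    \<open>{0..<s}\<close>, hence the shift by 1 around \<open>mod\<close> and
    \<open>div\<close>.\<close>
  proof (rule sum.reindex_bij_witness[where j = "\<lambda>(b, j). b + s * j"
        and i = "\<lambda>a. ((a - 1) mod s + 1, (a - 1) div s)"])
    fix z assume "z \<in> totatives s \<times> {..<p}"
    then obtain b j where z: "z = (b, j)" "0 < b" "b \<le> s" "coprime b s" "j < p"
      by (auto simp: in_totatives_iff)
    then have "b + s * j - 1 = (b - 1) + s * j" "b - 1 < s" by auto
    then have "(b + s * j - 1) div s = j" "(b + s * j - 1) mod s = b - 1" by simp_all
    then show "(((case z of (b, j) \<Rightarrow> b + s * j) - 1) mod s + 1, ((case z of (b, j) \<Rightarrow> b + s * j) - 1) div s) = z"
      using z by simp
    have "s * Suc j \<le> s * p" using z(5) by (intro mult_le_mono2) simp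
    then have "b + s * j \<le> p * s" using z(3) by (simp add: mult.commute[of p])
    moreover have "coprime (b + s * j) s" using z(4) gcd_add_mult[of s j b]
      by (simp add: coprime_iff_gcd_eq_1 gcd.commute[of _ s] add.commute mult.commute)
    ultimately show "(case z of (b, j) \<Rightarrow> b + s * j) \<in> {a. a \<in> {1..p * s} \<and> coprime a s}"
      using z by simp
  next
    fix a assume a: "a \<in> {a. a \<in> {1..p * s} \<and> coprime a s}"
    have eq: "(a - 1) mod s + 1 + s * ((a - 1) div s) = a"
      using a div_mult_mod_eq[of "a - 1" s] by (simp add: mult.commute)
    then show "(case ((a - 1) mod s + 1, (a - 1) div s) of (b, j) \<Rightarrow> b + s * j) = a" by simp
    have "(a - 1) mod s + 1 \<le> s" using assms(1) mod_less_divisor[of s "a - 1"] by linarith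
    moreover have "coprime ((a - 1) mod s + 1) s"
    proof (rule coprimeI)
      fix d assume d: "d dvd (a - 1) mod s + 1" "d dvd s"
      then have "d dvd (a - 1) mod s + 1 + s * ((a - 1) div s)" by (intro dvd_add[OF _ dvd_mult2])
      then have "d dvd a" unfolding eq .
      then show "is_unit d" using a d(2) coprime_common_divisor by blast
    qed
    moreover have "a - 1 < p * s" using a by auto
    then have "(a - 1) div s < p" by (rule less_mult_imp_div_less)
    ultimately show "((a - 1) mod s + 1, (a - 1) div s) \<in> totatives s \<times> {..<p}"
      by (simp add: in_totatives_iff)
  qed (auto split: prod.splits)
  finally show ?thesis ..
qed

text \<open>Writing a residue coprime to \<open>s\<close> as \<open>b + s * j\<close> leaves a
  complete sum over \<open>j < p\<close>, equal to \<open>p\<close> or 0; discarding the multiples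
  of \<open>p\<close> subtracts \<open>ramanujan_sum s n\<close>.\<close>

lemma ramanujan_sum_prime_mult:
  assumes "prime p" "\<not> p dvd s" "s > 0"
  shows "ramanujan_sum (p * s) n =
    (if p dvd n then of_nat p * ramanujan_sum s (n div p) else 0) - ramanujan_sum s n"
proof -
  have p: "p > 0" using assms prime_gt_0_nat by blast
  let ?f = "\<lambda>a. additive_char (real a * (real n / real (p * s)))"
  have "(\<Sum>a | a \<in> {1..p * s} \<and> coprime a s. ?f a)
      = ramanujan_sum (p * s) n + (\<Sum>a\<in>(*) p ` totatives s. ?f a)"
    unfolding totatives_prime_mult(1)[OF assms] ramanujan_sum_def
    using totatives_prime_mult(2)[OF assms] by (intro sum.union_disjoint) auto
  also have "(\<Sum>a\<in>(*) p ` totatives s. ?f a) = ramanujan_sum s n"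
    unfolding ramanujan_sum_def using p by (subst sum.reindex) (auto simp: inj_on_def o_def)
  finally have *: "ramanujan_sum (p * s) n =
      (\<Sum>a | a \<in> {1..p * s} \<and> coprime a s. ?f a) - ramanujan_sum s n" by simp
  have "(\<Sum>a | a \<in> {1..p * s} \<and> coprime a s. ?f a) = (\<Sum>b\<in>totatives s. \<Sum>j<p. ?f (b + s * j))"
    using assms p by (intro sum_coprime_residues)
  also have "\<dots> = (\<Sum>b\<in>totatives s. ?f b * (\<Sum>j<p. additive_char (real j * (real n / real p))))"
    unfolding sum_distrib_left additive_char_add[symmetric]
    using assms(3) by (intro sum.cong refl arg_cong[of _ _ additive_char]) (simp add: field_simps)
  also have "\<dots> = (if p dvd n then of_nat p * ramanujan_sum s (n div p) else 0)"
  proof (cases "p dvd n")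
    case True
    then have "?f b = additive_char (real b * (real (n div p) / real s))" for b
      using p by (simp add: real_of_nat_div)
    then show ?thesis
      unfolding sum_additive_char_residues[OF p] ramanujan_sum_def sum_distrib_left
      using True by (simp add: mult.commute)
  next
    case False
    then show ?thesis unfolding sum_additive_char_residues[OF p] by simp
  qed
  finally show ?thesis using * by simp
qed

theorem ramanujan_sum_squarefree:
  "squarefree q \<Longrightarrow> ramanujan_sum q n = (\<Prod>p\<in>prime_factors q. if p dvd n then of_nat p - 1 else - 1)"
proof (induction q arbitrary: n rule: less_induct)
  case (less q)
  show ?case
  proof (cases "q = 1")
    case True
    then show ?thesis by (simp add: ramanujan_sum_def)
  next
    case False
    then obtain p where p: "prime p" "p dvd q" using prime_factor_nat by blast
    then obtain s where q: "q = p * s" by auto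
    have s: "s > 0" using less.prems q by (intro Nat.gr0I) auto
    have "squarefree s" using squarefree_mono[of s q] less.prems q by simp
    have ps: "\<not> p dvd s"
    proof
      assume "p dvd s"
      then have "p ^ 2 dvd q" by (simp add: q power2_eq_square)
      from squarefreeD[OF less.prems this] show False using p(1) by simp
    qed
    have "s < q" using q s prime_gt_1_nat[OF p(1)] by simp
    have pf: "prime_factors q = insert p (prime_factors s)"
      using p(1) s prime_gt_0_nat[OF p(1)] by (simp add: q prime_factors_product prime_prime_factors)
    have "p \<notin> prime_factors s" using ps by auto
    \<comment> \<open>No prime factor of \<open>s\<close> equals \<open>p\<close>, so dividing
      \<open>n\<close> by \<open>p\<close> leaves every divisibility condition in the formula for
      \<open>s\<close> unchanged.\<close>
    have eq: "ramanujan_sum s (n div p) = ramanujan_sum s n" if "p dvd n"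
    proof -
      have "(l dvd n div p) = (l dvd n)" if "l \<in> prime_factors s" for l
      proof -
        have "coprime l p" using that ps p(1) primes_coprime[of l p] by auto
        then have "l dvd p * (n div p) \<longleftrightarrow> l dvd n div p" by (rule coprime_dvd_mult_right_iff)
        then show ?thesis using \<open>p dvd n\<close> by simp
      qed
      then show ?thesis
        unfolding less.IH[OF \<open>s < q\<close> \<open>squarefree s\<close>] by (intro prod.cong refl) simp
    qed
    have "ramanujan_sum q n = (if p dvd n then of_nat p - 1 else - 1) * ramanujan_sum s n"
      unfolding q ramanujan_sum_prime_mult[OF p(1) ps s] using eq by (simp add: algebra_simps)
    then show ?thesis
      unfolding pf less.IH[OF \<open>s < q\<close> \<open>squarefree s\<close>]
      using \<open>p \<notin> prime_factors s\<close> by simp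
  qed
qed

text \<open>A common shift \<open>b\<close> only twists the coefficients by a factor independent of
  \<open>a\<close>, so Ramanujan sums appear at every point of the arcs and not only at their
  centres.\<close>

lemma sum_totatives_exp_sum:
  "(\<Sum>a\<in>totatives q. exp_sum f N (real a / real q + b)) =
     (\<Sum>n=1..N. f n * additive_char (real n * b) * ramanujan_sum q n)"
proof -
  have "(\<Sum>a\<in>totatives q. exp_sum f N (real a / real q + b)) =
     (\<Sum>n=1..N. \<Sum>a\<in>totatives q. f n * additive_char (real n * (real a / real q + b)))"
    unfolding exp_sum_def by (rule sum.swap)
  also have "\<dots> = (\<Sum>n=1..N. f n * additive_char (real n * b) * ramanujan_sum q n)"
    unfolding ramanujan_sum_def sum_distrib_left mult.assoc additive_char_add[symmetric]
    by (intro sum.cong refl arg_cong2[of _ _ _ _ "(*)"] arg_cong[of _ _ additive_char])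
      (simp add: algebra_simps)
  finally show ?thesis .
qed

section \<open>The Dirichlet kernel\<close>

lemma cmod_additive_char_minus_1: "cmod (additive_char t - 1) = 2 * \<bar>sin (pi * t)\<bar>"
proof -
  have "(cmod (additive_char t - 1))\<^sup>2 = (cos (2 * (pi * t)) - 1)\<^sup>2 + (sin (2 * (pi * t)))\<^sup>2"
    by (simp add: additive_char_cis cmod_power2 mult.assoc)
  also have "\<dots> = (sin (2 * (pi * t)))\<^sup>2 + (cos (2 * (pi * t)))\<^sup>2 + 1 - 2 * cos (2 * (pi * t))"
    by (simp add: power2_eq_square algebra_simps)
  also have "\<dots> = 2 - 2 * cos (2 * (pi * t))" by simp
  also have "\<dots> = (2 * \<bar>sin (pi * t)\<bar>)\<^sup>2" by (simp add: cos_double_sin power_mult_distrib)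
  finally show ?thesis by (rule power2_eq_imp_eq) auto
qed

lemma exp_sum_one_geometric:
  "exp_sum (\<lambda>_. 1) N t * (additive_char t - 1) = additive_char t * (additive_char (real N * t) - 1)"
proof -
  have "exp_sum (\<lambda>_. 1) N t = (\<Sum>n=1..N. additive_char t ^ n)"
    by (simp add: exp_sum_def additive_char_power)
  also have "\<dots> * (additive_char t - 1) = additive_char t * (additive_char t ^ N - 1)"
    by (induction N) (simp_all add: algebra_simps)
  finally show ?thesis by (simp add: additive_char_power)
qed

text \<open>The product form remains valid at integers \<open>t\<close>, where the sine in the usual
  quotient vanishes.\<close>

lemma cmod_exp_sum_one:
  "cmod (exp_sum (\<lambda>_. 1) N t) * \<bar>sin (pi * t)\<bar> = \<bar>sin (pi * (real N * t))\<bar>"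
  using arg_cong[OF exp_sum_one_geometric[of N t], of cmod]
  by (simp add: norm_mult cmod_additive_char_minus_1)

lemma sin_ge_half: "0 \<le> x \<Longrightarrow> x \<le> pi / 3 \<Longrightarrow> x / 2 \<le> sin x"
proof -
  assume x: "0 \<le> x" "x \<le> pi / 3"
  have "sin 0 - 0 / 2 \<le> sin x - x / 2"
  proof (rule DERIV_nonneg_imp_nondecreasing[OF x(1)])
    fix z assume z: "0 \<le> z" "z \<le> x"
    have "cos (pi / 3) \<le> cos z" using x z by (intro cos_monotone_0_pi_le) auto
    then have "cos z - 1 / 2 \<ge> 0" by (simp add: cos_60)
    moreover have "((\<lambda>z. sin z - z / 2) has_real_derivative (cos z - 1 / 2)) (at z)"
      by (auto intro!: derivative_eq_intros)
    ultimately show "\<exists>y. ((\<lambda>z. sin z - z / 2) has_real_derivative y) (at z) \<and> 0 \<le> y" by blast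
  qed
  then show ?thesis by simp
qed

text \<open>By symmetry about \<open>t = 1/2\<close>, \<open>sin (pi * t)\<close> is smallest at the
  ends of the range. With \<open>r = 1 / (2 * q) \<le> 1/4\<close>, the argument
  \<open>pi * r\<close> stays below \<open>pi / 3\<close>, so the sine is at least
  \<open>pi * r / 2 \<ge> r\<close>.\<close>

lemma cmod_exp_sum_one_le:
  assumes "q \<ge> 2" "1 / (2 * q) \<le> t" "t \<le> 1 - 1 / (2 * q)"
  shows "cmod (exp_sum (\<lambda>_. 1) N t) \<le> 2 * q"
proof -
  define r where "r = 1 / (2 * q)"
  have r: "0 < r" "r \<le> 1 / 4" "r \<le> t" "r \<le> 1 - t"
    using assms by (auto simp: r_def field_simps)
  have mono: "sin (pi * r) \<le> sin (pi * s)" if "r \<le> s" "s \<le> 1 / 2" for s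
  proof (rule sin_monotone_2pi_le)
    have "0 < pi * r" using r by simp
    then show "- (pi / 2) \<le> pi * r" using pi_gt_zero by linarith
    show "pi * s \<le> pi / 2" using mult_left_mono[OF that(2), of pi] by simp
  qed (use that in simp)
  have "sin (pi * r) \<le> sin (pi * t)"
  proof (cases "t \<le> 1 / 2")
    case False
    have "sin (pi * (1 - t)) = sin (pi * t)" by (simp add: algebra_simps sin_diff)
    then show ?thesis using mono[of "1 - t"] r False by simp
  qed (use mono r in simp)
  moreover have "pi * r \<le> pi / 3" using mult_left_mono[OF r(2), of pi] by simp
  then have "pi * r / 2 \<le> sin (pi * r)" using r by (intro sin_ge_half) auto
  moreover have "r * 2 \<le> r * pi" using r pi_gt3 by (intro mult_left_mono) auto
  ultimately have "r \<le> sin (pi * t)" by (simp only: mult.commute[of pi])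
  then have "1 / (2 * q) \<le> \<bar>sin (pi * t)\<bar>" unfolding r_def by simp
  then have "cmod (exp_sum (\<lambda>_. 1) N t) * (1 / (2 * q)) \<le> cmod (exp_sum (\<lambda>_. 1) N t) * \<bar>sin (pi * t)\<bar>"
    by (intro mult_left_mono) auto
  also have "\<dots> \<le> 1" unfolding cmod_exp_sum_one by simp
  finally show ?thesis using assms(1) by (simp add: field_simps)
qed

section \<open>Lower bounds for integrals over minor arcs\<close>

lemma continuous_exp_sum [continuous_intros]: "continuous_on A (exp_sum f N)"
  unfolding exp_sum_def additive_char_def by (intro continuous_intros)

lemma continuous_cmod_exp_sum_sq: "continuous_on A (\<lambda>\<theta>. (cmod (exp_sum f N \<theta>))\<^sup>2)"
  by (intro continuous_intros)

lemma major_arcs_borel [measurable]: "major_arcs K Q\<^sub>0 Q \<in> sets borel"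
proof -
  have "major_arcs K Q\<^sub>0 Q = (\<Union>q\<in>{q::nat. 0 < q \<and> real q \<le> K * Q\<^sub>0}. \<Union>a\<in>{a::int. coprime a (int q)}.
      {real_of_int a / real q - K / (real q * Q) .. real_of_int a / real q + K / (real q * Q)})"
  proof (rule set_eqI)
    fix t :: real
    have eq: "\<bar>t - c\<bar> \<le> d \<longleftrightarrow> t \<in> {c - d..c + d}" for c d by auto
    show "t \<in> major_arcs K Q\<^sub>0 Q \<longleftrightarrow> t \<in> (\<Union>q\<in>{q::nat. 0 < q \<and> real q \<le> K * Q\<^sub>0}. \<Union>a\<in>{a::int. coprime a (int q)}.
      {real_of_int a / real q - K / (real q * Q) .. real_of_int a / real q + K / (real q * Q)})"
      unfolding major_arcs_def mem_Collect_eq eq UN_iff by blast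
  qed
  also have "\<dots> \<in> sets borel" by (intro sets.countable_UN'') auto
  finally show ?thesis .
qed

lemma minor_arcs_borel [measurable]: "minor_arcs K Q\<^sub>0 Q \<in> sets borel"
  unfolding minor_arcs_def by measurable

lemma set_integrable_continuous_subset:
  fixes F :: "real \<Rightarrow> real"
  assumes "continuous_on UNIV F" "A \<in> sets borel" "A \<subseteq> {a..b}"
  shows "set_integrable lborel A F"
proof (rule set_integrable_subset)
  show "set_integrable lborel {a..b} F"
    using assms(1) continuous_on_subset by (intro borel_integrable_atLeastAtMost') blast
qed (use assms in auto)

lemma set_integral_mono_subset:
  fixes F :: "real \<Rightarrow> real"
  assumes "set_integrable lborel B F" "A \<in> sets borel" "A \<subseteq> B" "\<And>x. F x \<ge> 0"
  shows "(LINT t:A|lborel. F t) \<le> (LINT t:B|lborel. F t)"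
  using set_integrable_subset[OF assms(1) _ assms(3)] assms(2,4) assms(1,3)
  unfolding set_lebesgue_integral_def set_integrable_def
  by (intro integral_mono) (auto simp: indicator_def)

lemma set_integral_FTC:
  fixes f F :: "real \<Rightarrow> real"
  assumes "a \<le> b" "\<And>x. (F has_real_derivative f x) (at x)" "continuous_on UNIV f"
  shows "(LINT t:{a..b}|lborel. f t) = F b - F a"
  using integral_FTC_Icc_real[of a b F f] assms
  by (simp add: set_lebesgue_integral_def mult.commute continuous_on_eq_continuous_at)

lemma set_integral_const_Icc:
  fixes c :: real
  shows "a \<le> b \<Longrightarrow> (LINT t:{a..b}|lborel. c) = (b - a) * c"
  by (simp add: set_lebesgue_integral_def)

text \<open>Translating all arcs to \<open>{-h..h}\<close> puts the sum over centres inside the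
  integral. A lower bound is then needed only for the sum at a common shift, which is what Ramanujan
  sums evaluate.\<close>

lemma arcs_integral_ge:
  fixes F :: "real \<Rightarrow> real"
  assumes F: "continuous_on UNIV F" "\<And>x. F x \<ge> 0"
    and A: "A \<in> sets borel" "A \<subseteq> {a..b}"
    and X: "finite X" "\<And>x. x \<in> X \<Longrightarrow> {x - h..x + h} \<subseteq> A"
    and disj: "disjoint_family_on (\<lambda>x. {x - h..x + h}) X"
    and h: "h > 0"
    and W: "\<And>t. \<bar>t\<bar> \<le> h \<Longrightarrow> W \<le> (\<Sum>x\<in>X. F (x + t))"
  shows "(LINT t:A|lborel. F t) \<ge> 2 * h * W"
proof -
  have int: "set_integrable lborel {c..d} G" if "continuous_on UNIV G" for c d and G :: "real \<Rightarrow> real"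
    using that by (intro set_integrable_continuous_subset[of _ _ c d]) auto
  have shift: "(LINT t:{x - h..x + h}|lborel. F t) = (LINT t:{-h..h}|lborel. F (x + t))" for x
  proof -
    have "(LINT t:{x - h..x + h}|lborel. F t)
        = (\<integral>t. indicator {x - h..x + h} (x + 1 * t) *\<^sub>R F (x + 1 * t) \<partial>lborel)"
      unfolding set_lebesgue_integral_def by (subst lborel_integral_real_affine[of 1 _ x]) auto
    also have "\<dots> = (LINT t:{-h..h}|lborel. F (x + t))"
      unfolding set_lebesgue_integral_def by (intro Bochner_Integration.integral_cong) (auto simp: indicator_def)
    finally show ?thesis .
  qed
  have cont: "continuous_on UNIV (\<lambda>t. F (x + t))" for x
    by (intro continuous_on_compose2[OF F(1)] continuous_intros) auto
  have union_borel: "(\<Union>x\<in>X. {x - h..x + h}) \<in> sets borel"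
    using X(1) by (intro sets.finite_UN) auto
  have "2 * h * W = (LINT t:{-h..h}|lborel. W)"
    using h by (simp add: set_integral_const_Icc)
  also have "\<dots> \<le> (LINT t:{-h..h}|lborel. \<Sum>x\<in>X. F (x + t))"
    using W by (intro set_integral_mono int continuous_intros cont) (auto simp: abs_le_iff)
  also have "\<dots> = (\<Sum>x\<in>X. LINT t:{-h..h}|lborel. F (x + t))"
    unfolding set_lebesgue_integral_def scaleR_sum_right
    using int[OF cont] by (intro Bochner_Integration.integral_sum) (auto simp: set_integrable_def)
  also have "\<dots> = (\<Sum>x\<in>X. LINT t:{x - h..x + h}|lborel. F t)" by (simp add: shift)
  also have "\<dots> = (LINT t:(\<Union>x\<in>X. {x - h..x + h})|lborel. F t)"
    using X(1) disj int[OF F(1)] by (intro set_integral_finite_Union[symmetric]) auto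
  also have "\<dots> \<le> (LINT t:A|lborel. F t)"
    using X(2) F(2) union_borel
    by (intro set_integral_mono_subset set_integrable_continuous_subset[OF F(1) A]) auto
  finally show ?thesis .
qed

section \<open>Parseval's identity and the integral near 0\<close>

lemma integral_cos_unit_period:
  fixes k :: int
  shows "(LINT t:{0..1}|lborel. cos (2 * pi * (real_of_int k * t))) = (if k = 0 then 1 else 0)"
proof (cases "k = 0")
  case False
  let ?G = "\<lambda>t. sin (2 * pi * (real_of_int k * t)) / (2 * pi * real_of_int k)"
  have "(LINT t:{0..1}|lborel. cos (2 * pi * (real_of_int k * t))) = ?G 1 - ?G 0"
  proof (rule set_integral_FTC)
    fix t show "(?G has_real_derivative cos (2 * pi * (real_of_int k * t))) (at t)"
      using False by (auto intro!: derivative_eq_intros simp: field_simps)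
  qed (auto intro!: continuous_intros)
  also have "\<dots> = 0" using sin_times_pi_eq_0[of "2 * real_of_int k"] by (simp add: mult_ac)
  finally show ?thesis using False by simp
qed (simp add: set_integral_const_Icc)

text \<open>For real coefficients the square of the modulus is a double sum of cosines of
  \<open>2 * pi * (m - n) * t\<close>, so orthogonality of cosines is all that enters.\<close>

lemma parseval_exp_sum:
  fixes g :: "nat \<Rightarrow> real"
  shows "(LINT t:{0..1}|lborel. (cmod (exp_sum (\<lambda>n. of_real (g n)) N t))\<^sup>2) = (\<Sum>n=1..N. (g n)\<^sup>2)"
proof -
  have sq: "(cmod (exp_sum (\<lambda>n. of_real (g n)) N t))\<^sup>2 =
      (\<Sum>m=1..N. \<Sum>n=1..N. g m * g n * cos (2 * pi * (real_of_int (int m - int n) * t)))" for t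
  proof -
    have "(cmod (exp_sum (\<lambda>n. of_real (g n)) N t))\<^sup>2 =
       (\<Sum>m=1..N. g m * cos (2 * pi * (real m * t))) * (\<Sum>n=1..N. g n * cos (2 * pi * (real n * t))) +
       (\<Sum>m=1..N. g m * sin (2 * pi * (real m * t))) * (\<Sum>n=1..N. g n * sin (2 * pi * (real n * t)))"
      unfolding cmod_power2 exp_sum_def additive_char_cis Re_sum Im_sum unfolding power2_eq_square by simp
    also have "\<dots> = (\<Sum>m=1..N. \<Sum>n=1..N. g m * g n * (cos (2 * pi * (real m * t)) * cos (2 * pi * (real n * t))
        + sin (2 * pi * (real m * t)) * sin (2 * pi * (real n * t))))"
      unfolding sum_product sum.distrib[symmetric] by (intro sum.cong refl) (simp add: algebra_simps)
    also have "\<dots> = (\<Sum>m=1..N. \<Sum>n=1..N. g m * g n * cos (2 * pi * (real_of_int (int m - int n) * t)))"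
      unfolding cos_diff[symmetric] by (simp add: algebra_simps)
    finally show ?thesis .
  qed
  have int: "set_integrable lborel {0..1::real} (\<lambda>t. g m * g n * cos (2 * pi * (real_of_int (int m - int n) * t)))" for m n
    by (rule set_integrable_continuous_subset[of _ _ 0 1]) (auto intro!: continuous_intros)
  have "(LINT t:{0..1}|lborel. (cmod (exp_sum (\<lambda>n. of_real (g n)) N t))\<^sup>2) =
      (\<Sum>m=1..N. \<Sum>n=1..N. LINT t:{0..1}|lborel. g m * g n * cos (2 * pi * (real_of_int (int m - int n) * t)))"
    unfolding sq set_lebesgue_integral_def scaleR_sum_right using int
    by (subst Bochner_Integration.integral_sum; (intro sum.cong refl Bochner_Integration.integral_sum Bochner_Integration.integrable_sum)?)
      (auto simp: set_integrable_def)
  also have "\<dots> = (\<Sum>m=1..N. \<Sum>n=1..N. if n = m then g m * g n else 0)"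
    unfolding set_integral_mult_right integral_cos_unit_period by (intro sum.cong refl) auto
  also have "\<dots> = (\<Sum>n=1..N. (g n)\<^sup>2)" by (simp add: power2_eq_square)
  finally show ?thesis .
qed

text \<open>On this interval the denominator of the squared kernel is at most
  \<open>(3 * pi * K / Q) ^ 2\<close>, while the numerator \<open>(sin (pi * N * t)) ^ 2\<close> has
  mean about 1/2, because the length \<open>K / Q\<close> is at least \<open>1 / N\<close>.\<close>

lemma near_zero_integral_ge:
  assumes K: "K \<ge> 1" and Q: "0 < Q" "Q \<le> real N"
  shows "(LINT t:{2 * K / Q..3 * K / Q}|lborel. (cmod (exp_sum (\<lambda>_. 1) N t))\<^sup>2) \<ge> Q / (36 * pi\<^sup>2 * K)"
proof -
  let ?I = "{2 * K / Q..3 * K / Q}"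
  define B where "B = (pi * (3 * K / Q))\<^sup>2"
  have B: "B > 0" using K Q by (simp add: B_def)
  have N: "real N > 0" using Q by simp
  let ?G = "\<lambda>t. (t / 2 - sin (2 * pi * real N * t) / (4 * pi * real N)) / B"
  have pt: "(sin (pi * (real N * t)))\<^sup>2 / B \<le> (cmod (exp_sum (\<lambda>_. 1) N t))\<^sup>2" if t: "t \<in> ?I" for t
  proof -
    have "0 \<le> 2 * K / Q" using K Q by simp
    then have t0: "t \<ge> 0" using t by (simp only: atLeastAtMost_iff) linarith
    have "\<bar>sin (pi * t)\<bar> \<le> pi * t" using abs_sin_x_le_abs_x[of "pi * t"] t0 by simp
    also have "\<dots> \<le> pi * (3 * K / Q)" using t by (intro mult_left_mono) auto
    finally have "(sin (pi * t))\<^sup>2 \<le> B" unfolding B_def by (rule sqrt_le_D[OF real_sqrt_abs[THEN eq_refl, THEN order_trans]])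
    have "(sin (pi * (real N * t)))\<^sup>2 = (cmod (exp_sum (\<lambda>_. 1) N t))\<^sup>2 * (sin (pi * t))\<^sup>2"
      using arg_cong[OF cmod_exp_sum_one[of N t], of "\<lambda>x. x\<^sup>2"] by (simp add: power_mult_distrib)
    also have "\<dots> \<le> (cmod (exp_sum (\<lambda>_. 1) N t))\<^sup>2 * B"
      using \<open>(sin (pi * t))\<^sup>2 \<le> B\<close> by (intro mult_left_mono) auto
    finally show ?thesis using B by (simp add: pos_divide_le_eq)
  qed
  have "Q / (36 * pi\<^sup>2 * K) = K / (4 * Q) / B"
    using K Q by (simp add: B_def power_divide power_mult_distrib field_simps power2_eq_square)
  \<comment> \<open>Before division by \<open>B\<close>, the linear part of \<open>?G\<close> yields
    \<open>K / (2 * Q)\<close>. Each oscillating boundary term is at most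
    \<open>K / (8 * Q)\<close>, so half of it survives.\<close>
  also have "\<dots> \<le> ?G (3 * K / Q) - ?G (2 * K / Q)"
  proof -
    have sin_le: "\<bar>sin x / (4 * pi * real N)\<bar> \<le> 1 / (4 * pi * real N)" for x
      using N by (simp add: divide_right_mono)
    have "1 / (4 * pi * real N) \<le> K / (8 * Q)"
    proof -
      have "1 / (4 * pi * real N) \<le> 1 / (8 * Q)"
        using Q N pi_gt3 by (intro divide_left_mono mult_mono) auto
      also have "\<dots> \<le> K / (8 * Q)" using K Q by (intro divide_right_mono) auto
      finally show ?thesis .
    qed
    moreover have "3 * K / Q / 2 - 2 * K / Q / 2 = K / (2 * Q)" using Q by (simp add: field_simps)
    moreover have "K / (2 * Q) = 4 * (K / (8 * Q))" "K / (4 * Q) = 2 * (K / (8 * Q))" by simp_all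
    moreover have arith: "k2 \<le> (x - s) - (y - r)"
      if "n \<le> k" "x - y = k4" "k4 = 4 * k" "k2 = 2 * k" "\<bar>s\<bar> \<le> n" "\<bar>r\<bar> \<le> n"
      for n k k2 k4 x y s r :: real
      using that by linarith
    ultimately have "K / (4 * Q) \<le> (3 * K / Q / 2 - sin (2 * pi * real N * (3 * K / Q)) / (4 * pi * real N))
       - (2 * K / Q / 2 - sin (2 * pi * real N * (2 * K / Q)) / (4 * pi * real N))"
      using sin_le[of "2 * pi * real N * (3 * K / Q)"] sin_le[of "2 * pi * real N * (2 * K / Q)"]
      by (intro arith)
    then show ?thesis unfolding diff_divide_distrib[symmetric] using B by (intro divide_right_mono) auto
  qed
  also have "\<dots> = (LINT t:?I|lborel. (sin (pi * (real N * t)))\<^sup>2 / B)"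
  proof (rule set_integral_FTC[symmetric])
    show "2 * K / Q \<le> 3 * K / Q" using K Q by (intro divide_right_mono) auto
    fix t
    have "(?G has_real_derivative (1 / 2 - cos (2 * pi * real N * t) * (2 * pi * real N) / (4 * pi * real N)) / B) (at t)"
      using N B by (auto intro!: derivative_eq_intros)
    also have "cos (2 * pi * real N * t) * (2 * pi * real N) / (4 * pi * real N) = cos (2 * (pi * (real N * t))) / 2"
      using N by (simp add: mult.assoc)
    also have "1 / 2 - cos (2 * (pi * (real N * t))) / 2 = (sin (pi * (real N * t)))\<^sup>2"
      unfolding cos_double_sin diff_divide_distrib by simp
    finally show "(?G has_real_derivative (sin (pi * (real N * t)))\<^sup>2 / B) (at t)" .
  qed (use B in \<open>auto intro!: continuous_intros\<close>)
  also have "\<dots> \<le> (LINT t:?I|lborel. (cmod (exp_sum (\<lambda>_. 1) N t))\<^sup>2)"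
    using pt B by (intro set_integral_mono set_integrable_continuous_subset[of _ _ "2 * K / Q" "3 * K / Q"] continuous_intros) auto
  finally show ?thesis .
qed

text \<open>From \<open>(x + y) ^ 2 \<le> 2 * x ^ 2 + 2 * y ^ 2\<close>; the part with
  \<open>g\<close> is extended to the whole period, where Parseval evaluates it.\<close>

lemma set_integral_cmod_sq_diff_ge:
  assumes "A \<in> sets borel" "A \<subseteq> {0..1}"
  shows "(LINT t:A|lborel. (cmod (exp_sum (\<lambda>n. f n - of_real (g n)) N t))\<^sup>2)
     \<ge> (LINT t:A|lborel. (cmod (exp_sum f N t))\<^sup>2) / 2 - (\<Sum>n=1..N. (g n)\<^sup>2)"
proof -
  note int = set_integrable_continuous_subset[OF continuous_cmod_exp_sum_sq]
  have pt: "(cmod (exp_sum f N t))\<^sup>2 / 2 - (cmod (exp_sum (\<lambda>n. of_real (g n)) N t))\<^sup>2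
     \<le> (cmod (exp_sum (\<lambda>n. f n - of_real (g n)) N t))\<^sup>2" for t
  proof -
    let ?x = "cmod (exp_sum (\<lambda>n. f n - of_real (g n)) N t)" and ?y = "cmod (exp_sum (\<lambda>n. of_real (g n)) N t)"
    have "exp_sum f N t = exp_sum (\<lambda>n. f n - of_real (g n)) N t + exp_sum (\<lambda>n. of_real (g n)) N t"
      by (simp add: exp_sum_def sum.distrib[symmetric] algebra_simps)
    then have "cmod (exp_sum f N t) \<le> ?x + ?y" by (simp add: norm_triangle_ineq)
    then have "(cmod (exp_sum f N t))\<^sup>2 \<le> (?x + ?y)\<^sup>2" by (intro power_mono) auto
    also have "\<dots> \<le> 2 * ?x\<^sup>2 + 2 * ?y\<^sup>2"
      using zero_le_power2[of "?x - ?y"] by (simp add: power2_eq_square algebra_simps)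
    finally show ?thesis by simp
  qed
  have "(LINT t:A|lborel. (cmod (exp_sum f N t))\<^sup>2) / 2 - (LINT t:A|lborel. (cmod (exp_sum (\<lambda>n. of_real (g n)) N t))\<^sup>2)
      = (LINT t:A|lborel. (cmod (exp_sum f N t))\<^sup>2 / 2 - (cmod (exp_sum (\<lambda>n. of_real (g n)) N t))\<^sup>2)"
    using int[OF assms] by (subst set_integral_diff(2)) auto
  also have "\<dots> \<le> (LINT t:A|lborel. (cmod (exp_sum (\<lambda>n. f n - of_real (g n)) N t))\<^sup>2)"
    using pt int[OF assms] by (intro set_integral_mono set_integral_diff(1)) auto
  finally have 1: "(LINT t:A|lborel. (cmod (exp_sum f N t))\<^sup>2) / 2
      - (LINT t:A|lborel. (cmod (exp_sum (\<lambda>n. of_real (g n)) N t))\<^sup>2)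
      \<le> (LINT t:A|lborel. (cmod (exp_sum (\<lambda>n. f n - of_real (g n)) N t))\<^sup>2)" .
  have "(LINT t:A|lborel. (cmod (exp_sum (\<lambda>n. of_real (g n)) N t))\<^sup>2)
      \<le> (LINT t:{0..1}|lborel. (cmod (exp_sum (\<lambda>n. of_real (g n)) N t))\<^sup>2)"
    using assms by (intro set_integral_mono_subset int[of _ 0 1]) auto
  then show ?thesis using 1 unfolding parseval_exp_sum by linarith
qed

section \<open>Non-smooth numbers\<close>

definition large_primes :: "nat \<Rightarrow> real \<Rightarrow> nat set" where
  "large_primes N y = {p. prime p \<and> y < real p \<and> real p \<le> real N}"

lemma finite_large_primes [simp]: "finite (large_primes N y)"
  unfolding large_primes_def by (rule finite_primes_real)

text \<open>Two distinct primes above \<open>y \<ge> sqrt N\<close> have a product exceeding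
  \<open>N\<close>. The condition \<open>u \<le> 2\<close> is used here.\<close>

lemma large_prime_divisor_unique:
  assumes "real N \<le> y\<^sup>2" "0 < y" "p \<in> large_primes N y" "q \<in> large_primes N y"
    and "p dvd n" "q dvd n" "0 < n" "n \<le> N"
  shows "p = q"
proof (rule ccontr)
  assume "p \<noteq> q"
  then have "coprime p q" using assms primes_coprime unfolding large_primes_def by blast
  then have "p * q dvd n" using assms by (simp add: divides_mult)
  then have "p * q \<le> N" using assms dvd_imp_le[of "p * q" n] by linarith
  then have "real (p * q) \<le> real N" by (rule of_nat_mono)
  then have "real p * real q \<le> real N" by simp
  moreover have "y * y < real p * real q"
    using assms unfolding large_primes_def by (intro mult_strict_mono) auto
  ultimately show False using assms(1) by (simp add: power2_eq_square)
qed

lemma sum_nonsmooth: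
  fixes f :: "nat \<Rightarrow> 'a :: comm_monoid_add"
  assumes "real N \<le> y\<^sup>2" "0 < y"
  shows "(\<Sum>n\<in>{1..N} - smooth_numbers y. f n) = (\<Sum>p\<in>large_primes N y. \<Sum>m=1..N div p. f (m * p))"
proof -
  have "(\<Sum>p\<in>large_primes N y. \<Sum>m=1..N div p. f (m * p))
      = (\<Sum>(p, m)\<in>(SIGMA p:large_primes N y. {1..N div p}). f (m * p))"
    by (rule sum.Sigma) auto
  also have "\<dots> = (\<Sum>n\<in>(\<lambda>(p, m). m * p) ` (SIGMA p:large_primes N y. {1..N div p}). f n)"
  proof (subst sum.reindex)
    show "inj_on (\<lambda>(p, m). m * p) (SIGMA p:large_primes N y. {1..N div p})"
    proof (rule inj_onI, clarify)
      fix p m p' m' assume *: "p \<in> large_primes N y" "m \<in> {1..N div p}" "p' \<in> large_primes N y"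
        "m' \<in> {1..N div p'}" "m * p = m' * p'"
      have pos: "p > 0" "p' > 0" using * by (auto simp: large_primes_def prime_gt_0_nat)
      have "m * p \<le> N" using * pos by (simp add: less_eq_div_iff_mult_less_eq)
      have "p' dvd m * p" by (simp only: *(5) dvd_triv_right)
      then have "p = p'"
        by (intro large_prime_divisor_unique[OF assms *(1,3) dvd_triv_right[of p m]])
          (use \<open>p' dvd m * p\<close> *(2) pos \<open>m * p \<le> N\<close> in simp_all)
      then show "p = p' \<and> m = m'" using * pos by simp
    qed
  qed (auto intro!: sum.cong)
  also have "(\<lambda>(p, m). m * p) ` (SIGMA p:large_primes N y. {1..N div p}) = {1..N} - smooth_numbers y"
  proof (intro equalityI subsetI)
    fix n assume "n \<in> (\<lambda>(p, m). m * p) ` (SIGMA p:large_primes N y. {1..N div p})"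
    then obtain p m where *: "p \<in> large_primes N y" "m \<in> {1..N div p}" "n = m * p" by auto
    have pos: "p > 0" using * by (auto simp: large_primes_def prime_gt_0_nat)
    have "n \<le> N" "n \<ge> 1" using * pos by (auto simp: less_eq_div_iff_mult_less_eq Suc_le_eq)
    moreover have "p dvd n" "\<not> real p \<le> y" "prime p" using * by (auto simp: large_primes_def)
    ultimately show "n \<in> {1..N} - smooth_numbers y" unfolding smooth_numbers_def by auto
  next
    fix n assume n: "n \<in> {1..N} - smooth_numbers y"
    then obtain p where p: "prime p" "p dvd n" "y < real p"
      unfolding smooth_numbers_def by (auto simp: not_le)
    then obtain m where m: "n = m * p" by (auto simp: mult.commute elim: dvdE)
    have "p \<le> n" using p n by (intro dvd_imp_le) auto
    then have "p \<in> large_primes N y" using p n by (auto simp: large_primes_def)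
    moreover have "m * p \<le> N" "m \<noteq> 0" using n m by auto
    then have "m \<in> {1..N div p}"
      using less_eq_div_iff_mult_less_eq[of p m N] prime_gt_0_nat[OF p(1)] by simp
    ultimately have "(p, m) \<in> (SIGMA p:large_primes N y. {1..N div p})" by simp
    then show "n \<in> (\<lambda>(p, m). m * p) ` (SIGMA p:large_primes N y. {1..N div p})"
      by (rule image_eqI[rotated]) (simp add: m)
  qed
  finally show ?thesis ..
qed

text \<open>The Ramanujan sum of prime modulus \<open>l\<close>, as a real number.\<close>

definition prime_weight :: "nat \<Rightarrow> nat \<Rightarrow> real" where
  "prime_weight l m = (if l dvd m then real l - 1 else - 1)"

text \<open>The value is never positive, so the contributions of different large primes cannot
  cancel; it is \<open>- k\<close> as soon as \<open>k < l\<close>.\<close>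

lemma sum_prime_weight:
  assumes "l > 0"
  shows "(\<Sum>m=1..k. prime_weight l m) = - real (k mod l)"
proof -
  have "(\<Sum>m=1..k. prime_weight l m) = (\<Sum>m=1..k. (if l dvd m then real l else 0) - 1)"
    by (intro sum.cong) (auto simp: prime_weight_def)
  also have "\<dots> = (\<Sum>m | m \<in> {1..k} \<and> l dvd m. real l) - real k"
    by (simp only: sum_subtractf sum.inter_filter[OF finite_atLeastAtMost]) simp
  also have "\<dots> = real (k div l * l) - real k"
    using card_multiples[OF assms, of k] by simp
  also have "\<dots> = - real (k mod l)"
    using arg_cong[OF div_mult_mod_eq[of k l], of real] unfolding of_nat_add by linarith
  finally show ?thesis .
qed

lemma sum_abs_prime_weight_le:
  assumes "l > 0"
  shows "(\<Sum>m=1..k. \<bar>prime_weight l m\<bar>) \<le> 2 * real k"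
proof -
  have "(\<Sum>m=1..k. \<bar>prime_weight l m\<bar>) \<le> (\<Sum>m=1..k. (if l dvd m then real l else 0) + 1)"
    using assms by (intro sum_mono) (auto simp: prime_weight_def)
  also have "\<dots> = (\<Sum>m | m \<in> {1..k} \<and> l dvd m. real l) + real k"
    by (simp only: sum.distrib sum.inter_filter[OF finite_atLeastAtMost]) simp
  also have "\<dots> = real (k div l * l) + real k"
    using card_multiples[OF assms, of k] by simp
  also have "real (k div l * l) \<le> real k" by (intro of_nat_mono) simp
  finally show ?thesis by simp
qed

text \<open>A prime factor \<open>q\<close> of \<open>r\<close> satisfies
  \<open>q > N / y > m\<close> and \<open>q \<le> r \<le> y < p\<close>, so it divides neither
  \<open>m\<close> nor \<open>p\<close> and contributes \<open>- 1\<close>. Since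
  \<open>l \<le> y < p\<close>, only the divisibility of \<open>m\<close> by \<open>l\<close>
  matters. The resulting sign depends on \<open>r\<close> alone.\<close>

lemma ramanujan_sum_nonsmooth:
  assumes r: "squarefree r" "\<And>q. prime q \<Longrightarrow> q dvd r \<Longrightarrow> real N / y < real q" "0 < r" "real r \<le> y"
    and l: "prime l" "\<not> l dvd r" "real l \<le> y"
    and n: "p \<in> large_primes N y" "m \<in> {1..N div p}" and y: "0 < y"
  shows "ramanujan_sum (r * l) (m * p) = (- 1) ^ card (prime_factors r) * of_real (prime_weight l m)"
proof -
  have p: "prime p" "y < real p" "p > 0" using n by (auto simp: large_primes_def prime_gt_0_nat)
  have "coprime r l" using l prime_imp_coprime coprime_commute by blast
  then have sq: "squarefree (r * l)" using r(1) squarefree_prime[OF l(1)] by (simp add: squarefree_mult_coprime)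
  have pf: "prime_factors (r * l) = insert l (prime_factors r)"
    using l(1) r(3) prime_gt_0_nat[OF l(1)] by (simp add: prime_factors_product prime_prime_factors)
  have l_dvd: "l dvd m * p \<longleftrightarrow> l dvd m"
  proof -
    have "l \<noteq> p" using l(3) p(2) by auto
    then have "coprime l p" using primes_coprime[OF l(1) p(1)] by simp
    then show ?thesis by (rule coprime_dvd_mult_left_iff)
  qed
  have r_ndvd: "\<not> q dvd m * p" if "q \<in> prime_factors r" for q
  proof
    assume "q dvd m * p"
    have q: "prime q" "q dvd r" using that by auto
    have "real q \<le> real r" using q(2) r(3) dvd_imp_le by simp
    then have "q \<noteq> p" using r(4) p(2) by auto
    then have "q dvd m" using \<open>q dvd m * p\<close> q(1) p(1) prime_dvd_multD[of q m p] primes_dvd_imp_eq[of q p]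
      by blast
    then have "real q \<le> real m" using n(2) dvd_imp_le[of q m] by simp
    also have "real m \<le> real N / real p"
      using n(2) order_trans[OF of_nat_mono of_nat_div_le_of_nat, of m N p] by simp
    also have "\<dots> \<le> real N / y" using p y by (intro divide_left_mono) auto
    finally show False using r(2)[OF q] by simp
  qed
  have "ramanujan_sum (r * l) (m * p)
      = (if l dvd m * p then of_nat l - 1 else - 1) * (\<Prod>q\<in>prime_factors r. if q dvd m * p then of_nat q - 1 else - 1)"
    unfolding ramanujan_sum_squarefree[OF sq] pf using l(2) by (subst prod.insert) auto
  also have "(\<Prod>q\<in>prime_factors r. if q dvd m * p then of_nat q - 1 else - 1) = (\<Prod>q\<in>prime_factors r. - 1 :: complex)"
    using r_ndvd by (intro prod.cong refl) auto
  finally show ?thesis by (simp add: l_dvd prime_weight_def)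
qed

text \<open>At \<open>b = 0\<close> the sum is exact. Shifting moves each character by at most
  \<open>2 * pi * N * \<bar>b\<bar>\<close>, and the absolute weights over
  \<open>m \<le> N div p\<close> add up to at most \<open>2 * (N div p)\<close>; this gives the
  factor \<open>4 * pi\<close>.\<close>

lemma nonsmooth_ramanujan_ge:
  assumes r: "squarefree r" "\<And>q. prime q \<Longrightarrow> q dvd r \<Longrightarrow> real N / y < real q" "0 < r" "real r \<le> y"
    and l: "prime l" "\<not> l dvd r" "real l \<le> y"
    and y: "0 < y" "real N \<le> y\<^sup>2"
  shows "cmod (\<Sum>n\<in>{1..N} - smooth_numbers y. additive_char (real n * b) * ramanujan_sum (r * l) n)
    \<ge> (\<Sum>p\<in>large_primes N y. real ((N div p) mod l))
       - 4 * pi * (real N * \<bar>b\<bar>) * (\<Sum>p\<in>large_primes N y. real (N div p))"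
proof -
  let ?P = "large_primes N y" and ?c = "ramanujan_sum (r * l)"
  have lpos: "l > 0" using l(1) prime_gt_0_nat by blast
  note eval = ramanujan_sum_nonsmooth[OF r l _ _ y(1)]
  define \<epsilon> :: complex where "\<epsilon> = (- 1) ^ card (prime_factors r)"
  have \<epsilon>: "cmod \<epsilon> = 1" by (simp add: \<epsilon>_def norm_power)
  have "(\<Sum>n\<in>{1..N} - smooth_numbers y. ?c n) = (\<Sum>p\<in>?P. \<Sum>m=1..N div p. \<epsilon> * of_real (prime_weight l m))"
    unfolding sum_nonsmooth[OF y(2,1)] by (intro sum.cong refl) (simp only: eval \<epsilon>_def)
  also have "\<dots> = \<epsilon> * of_real (\<Sum>p\<in>?P. - real ((N div p) mod l))"
    unfolding sum_prime_weight[OF lpos, symmetric] of_real_sum sum_distrib_left ..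
  finally have main: "cmod (\<Sum>n\<in>{1..N} - smooth_numbers y. ?c n) = (\<Sum>p\<in>?P. real ((N div p) mod l))"
    by (simp only: norm_mult \<epsilon> sum_negf norm_of_real) (simp add: sum_nonneg)
  have "cmod (\<Sum>n\<in>{1..N} - smooth_numbers y. (additive_char (real n * b) - 1) * ?c n)
      \<le> (\<Sum>n\<in>{1..N} - smooth_numbers y. 2 * pi * (real N * \<bar>b\<bar>) * cmod (?c n))"
  proof (rule sum_norm_le)
    fix n assume n: "n \<in> {1..N} - smooth_numbers y"
    have "cmod (additive_char (real n * b) - 1) \<le> 2 * \<bar>pi * (real n * b)\<bar>"
      unfolding cmod_additive_char_minus_1 by (intro mult_left_mono abs_sin_x_le_abs_x) auto
    also have "\<dots> = 2 * pi * (real n * \<bar>b\<bar>)" by (simp add: abs_mult)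
    also have "\<dots> \<le> 2 * pi * (real N * \<bar>b\<bar>)" using n by (intro mult_left_mono mult_right_mono) auto
    finally show "cmod ((additive_char (real n * b) - 1) * ?c n) \<le> 2 * pi * (real N * \<bar>b\<bar>) * cmod (?c n)"
      unfolding norm_mult by (intro mult_right_mono) auto
  qed
  also have "\<dots> = 2 * pi * (real N * \<bar>b\<bar>) * (\<Sum>n\<in>{1..N} - smooth_numbers y. cmod (?c n))"
    by (rule sum_distrib_left[symmetric])
  also have "(\<Sum>n\<in>{1..N} - smooth_numbers y. cmod (?c n)) = (\<Sum>p\<in>?P. \<Sum>m=1..N div p. \<bar>prime_weight l m\<bar>)"
    unfolding sum_nonsmooth[OF y(2,1)]
    by (intro sum.cong refl) (simp only: eval norm_mult norm_power norm_minus_cancel norm_one power_one norm_of_real mult_1)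
  also have "2 * pi * (real N * \<bar>b\<bar>) * \<dots> \<le> 2 * pi * (real N * \<bar>b\<bar>) * (\<Sum>p\<in>?P. 2 * real (N div p))"
    by (intro mult_left_mono sum_mono sum_abs_prime_weight_le lpos) auto
  also have "\<dots> = 4 * pi * (real N * \<bar>b\<bar>) * (\<Sum>p\<in>?P. real (N div p))"
    by (simp add: sum_distrib_left[symmetric])
  finally have pert: "cmod (\<Sum>n\<in>{1..N} - smooth_numbers y. (additive_char (real n * b) - 1) * ?c n)
     \<le> 4 * pi * (real N * \<bar>b\<bar>) * (\<Sum>p\<in>?P. real (N div p))" .
  have split: "(\<Sum>n\<in>{1..N} - smooth_numbers y. ?c n) = (\<Sum>n\<in>{1..N} - smooth_numbers y. additive_char (real n * b) * ?c n)
     - (\<Sum>n\<in>{1..N} - smooth_numbers y. (additive_char (real n * b) - 1) * ?c n)"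
    unfolding sum_subtractf[symmetric] by (simp add: algebra_simps)
  show ?thesis
    using main pert norm_triangle_ineq4[of "\<Sum>n\<in>{1..N} - smooth_numbers y. additive_char (real n * b) * ?c n"
      "\<Sum>n\<in>{1..N} - smooth_numbers y. (additive_char (real n * b) - 1) * ?c n"]
    unfolding split[symmetric] by linarith
qed

lemma sum_indicator_smooth:
  fixes h :: "nat \<Rightarrow> complex"
  shows "(\<Sum>n=1..N. indicator (smooth_numbers y) n * h n) = (\<Sum>n=1..N. h n) - (\<Sum>n\<in>{1..N} - smooth_numbers y. h n)"
proof -
  have "(\<Sum>n=1..N. indicator (smooth_numbers y) n * h n) = (\<Sum>n\<in>{1..N} \<inter> smooth_numbers y. h n)"
    by (simp add: sum.inter_restrict indicator_def if_distrib[of "\<lambda>x. x * _"] cong: if_cong)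
  moreover have "(\<Sum>n=1..N. h n) = (\<Sum>n\<in>{1..N} \<inter> smooth_numbers y. h n) + (\<Sum>n\<in>{1..N} - smooth_numbers y. h n)"
    by (subst sum.union_disjoint[symmetric]) (auto intro!: sum.cong)
  ultimately show ?thesis by simp
qed

lemma totatives_shift_bounds:
  assumes "a \<in> totatives q" "q \<ge> 2" "\<bar>b\<bar> \<le> 1 / (2 * real q)"
  shows "1 / (2 * real q) \<le> real a / real q + b" "real a / real q + b \<le> 1 - 1 / (2 * real q)"
proof -
  have a: "1 \<le> a" "a < q" using assms totatives_less[of a q] by (auto simp: in_totatives_iff Suc_le_eq)
  have q: "real q > 0" using assms by simp
  have "1 / real q \<le> real a / real q" using a q by (intro divide_right_mono) auto
  moreover have "real a / real q \<le> (real q - 1) / real q" using a q by (intro divide_right_mono) auto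
  moreover have "(real q - 1) / real q = 1 - 1 / real q" using q by (simp add: field_simps)
  moreover have "1 / real q = 2 * (1 / (2 * real q))" by simp
  ultimately show "1 / (2 * real q) \<le> real a / real q + b" "real a / real q + b \<le> 1 - 1 / (2 * real q)"
    using assms(3) by linarith+
qed

text \<open>Cauchy-Schwarz over at most \<open>q = r * l\<close> fractions. The smooth sum is the
  full sum minus the non-smooth one, and the full sum costs \<open>2 * q ^ 2\<close>: at most
  \<open>q\<close> values of the Dirichlet kernel, each at most \<open>2 * q\<close>.\<close>

lemma sum_totatives_cmod_sq_ge:
  assumes r: "squarefree r" "\<And>q. prime q \<Longrightarrow> q dvd r \<Longrightarrow> real N / y < real q" "0 < r" "real r \<le> y"
    and l: "prime l" "\<not> l dvd r" "real l \<le> y"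
    and y: "0 < y" "real N \<le> y\<^sup>2"
    and b: "\<bar>b\<bar> \<le> 1 / (2 * real (r * l))"
    and V: "0 \<le> V" "V \<le> (\<Sum>p\<in>large_primes N y. real ((N div p) mod l))
       - 4 * pi * (real N * \<bar>b\<bar>) * (\<Sum>p\<in>large_primes N y. real (N div p)) - 2 * (real (r * l))\<^sup>2"
  shows "(\<Sum>a\<in>totatives (r * l). (cmod (exp_sum (indicator (smooth_numbers y)) N (real a / real (r * l) + b)))\<^sup>2)
     \<ge> V\<^sup>2 / real (r * l)"
proof -
  define q where "q = r * l"
  have "l \<ge> 2" using l(1) prime_ge_2_nat by blast
  then have q: "q \<ge> 2" using r(3) mult_le_mono[of 1 r 2 l] unfolding q_def by simp
  let ?S = "\<lambda>a. exp_sum (indicator (smooth_numbers y)) N (real a / real q + b)"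
  have card: "real (card (totatives q)) \<le> real q"
    using totient_le[of q] by (simp add: totient_def)
  let ?g = "\<Sum>n\<in>{1..N} - smooth_numbers y. additive_char (real n * b) * ramanujan_sum q n"
  have "(\<Sum>a\<in>totatives q. ?S a) = (\<Sum>n=1..N. indicator (smooth_numbers y) n * (additive_char (real n * b) * ramanujan_sum q n))"
    unfolding sum_totatives_exp_sum by (simp add: mult.assoc)
  also have "\<dots> = (\<Sum>a\<in>totatives q. exp_sum (\<lambda>_. 1) N (real a / real q + b)) - ?g"
    unfolding sum_indicator_smooth sum_totatives_exp_sum by simp
  finally have "?g = (\<Sum>a\<in>totatives q. exp_sum (\<lambda>_. 1) N (real a / real q + b)) - (\<Sum>a\<in>totatives q. ?S a)"
    by simp
  then have "cmod ?g \<le> cmod (\<Sum>a\<in>totatives q. exp_sum (\<lambda>_. 1) N (real a / real q + b)) + cmod (\<Sum>a\<in>totatives q. ?S a)"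
    by (simp only: norm_triangle_ineq4)
  moreover have "cmod (\<Sum>a\<in>totatives q. exp_sum (\<lambda>_. 1) N (real a / real q + b)) \<le> 2 * (real q)\<^sup>2"
  proof -
    have "cmod (\<Sum>a\<in>totatives q. exp_sum (\<lambda>_. 1) N (real a / real q + b)) \<le> (\<Sum>a\<in>totatives q. 2 * real q)"
    proof (rule sum_norm_le)
      fix a assume "a \<in> totatives q"
      have "2 \<le> real q" using of_nat_mono[OF q] by simp
      from cmod_exp_sum_one_le[OF this totatives_shift_bounds[OF \<open>a \<in> totatives q\<close> q b[folded q_def]]]
      show "cmod (exp_sum (\<lambda>_. 1) N (real a / real q + b)) \<le> 2 * real q" .
    qed
    also have "\<dots> = real (card (totatives q)) * (2 * real q)" by simp
    also have "\<dots> \<le> real q * (2 * real q)" using card by (intro mult_right_mono) auto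
    finally show ?thesis by (simp add: power2_eq_square)
  qed
  moreover note nonsmooth_ramanujan_ge[OF r l y, of b]
  ultimately have "V \<le> cmod (\<Sum>a\<in>totatives q. ?S a)" using V(2) unfolding q_def by linarith
  also have "\<dots> \<le> (\<Sum>a\<in>totatives q. cmod (?S a))" by (rule norm_sum)
  finally have "V\<^sup>2 \<le> (\<Sum>a\<in>totatives q. cmod (?S a) * 1)\<^sup>2" using V(1) by (intro power_mono) auto
  also have "\<dots> \<le> (\<Sum>a\<in>totatives q. (cmod (?S a))\<^sup>2) * (\<Sum>a\<in>totatives q. 1\<^sup>2)"
    by (rule Cauchy_Schwarz_ineq_sum)
  also have "\<dots> \<le> (\<Sum>a\<in>totatives q. (cmod (?S a))\<^sup>2) * real q"
    using card by (intro mult_left_mono sum_nonneg) auto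
  finally show ?thesis using q unfolding q_def[symmetric] by (simp add: pos_divide_le_eq)
qed

section \<open>The arcs around the fractions with denominator \<open>r l\<close>\<close>

text \<open>Reduced representations are unique, so the numerator \<open>a * q' - a' * q\<close> of
  the difference is a nonzero integer.\<close>

lemma fraction_distance_ge:
  fixes a a' :: int and q q' :: nat
  assumes "coprime a (int q)" "coprime a' (int q')" "q > 0" "q' > 0" "(a, q) \<noteq> (a', q')"
  shows "1 / (real q * real q') \<le> \<bar>real_of_int a / real q - real_of_int a' / real q'\<bar>"
proof -
  have "a * int q' - a' * int q \<noteq> 0"
  proof
    assume "a * int q' - a' * int q = 0"
    then have eq: "a * int q' = a' * int q" by simp
    have "int q dvd a * int q'" "int q' dvd a' * int q" using eq by (metis dvd_triv_right)+
    then have "int q dvd int q'" "int q' dvd int q"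
      using assms(1,2) by (simp_all add: coprime_dvd_mult_right_iff coprime_commute)
    then have "q = q'" by (simp add: dvd_antisym)
    then show False using eq assms by simp
  qed
  then have "1 \<le> \<bar>a * int q' - a' * int q\<bar>" by linarith
  then have "real_of_int 1 \<le> real_of_int \<bar>a * int q' - a' * int q\<bar>" by (simp only: of_int_le_iff)
  then have 1: "1 \<le> \<bar>real_of_int a * real q' - real_of_int a' * real q\<bar>" by simp
  have "\<bar>real_of_int a / real q - real_of_int a' / real q'\<bar>
      = \<bar>(real_of_int a * real q' - real_of_int a' * real q) / (real q * real q')\<bar>"
    using assms(3,4) by (subst diff_frac_eq) auto
  also have "\<dots> = \<bar>real_of_int a * real q' - real_of_int a' * real q\<bar> / (real q * real q')"
    by (simp add: abs_mult)
  finally show ?thesis using 1 assms(3,4) by (simp add: divide_right_mono)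
qed

text \<open>Collects what a large \<open>C\<close> and a large \<open>N\<close> provide.
  \<open>E\<close> and \<open>c\<close> come from Mertens' theorem and the rough reciprocal sum.
  \<open>ln M \<ge> 4 * E\<close> and \<open>L \<ge> 8 * E / \<delta>\<close> let the main terms
  absorb the Mertens error, and \<open>H\<close> is a small power of \<open>N\<close> that dominates
  \<open>L ^ 17\<close> and \<open>K\<close>.\<close>

locale smooth_minor_arcs =
  fixes E c \<delta> K Q Q\<^sub>0 y M L H :: real and N :: nat
  assumes E_pos: "E > 0"
    and mertens: "\<And>a b. 1 \<le> a \<Longrightarrow> a \<le> b \<Longrightarrow>
       \<bar>(\<Sum>p | prime p \<and> a < real p \<and> real p \<le> b. ln (real p) / real p) - ln (b / a)\<bar> \<le> E"
    and c_pos: "c > 0"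
    and rough: "\<And>M Y. M > 0 \<Longrightarrow> ln M \<ge> 1 \<Longrightarrow> Y \<ge> 1 \<Longrightarrow>
       (\<Sum>r\<in>rough_squarefree M Y. 1 / real r) \<ge> c * ln Y / ln M"
    and \<delta>: "0 < \<delta>" "\<delta> \<le> 1 / 8" and K: "K \<ge> 1"
    and N: "N \<ge> 2" and L_def: "L = ln (real N)" and H_def: "H = real N powr (\<delta> / 2)"
    and L: "L \<ge> 1" "L \<ge> 8 * E / \<delta>"
    and H: "H \<ge> 128 * L" "H > L ^ 17" "H > 8 * K"
    and Q: "real N powr (1 / 2 + \<delta>) \<le> Q" "Q \<le> real N"
    and Q0: "K * Q\<^sub>0 \<le> real N powr (1 / 2 - \<delta>) * L ^ 17"
    and M_def: "M = real N / y"
    and y: "y > 1" "ln y \<ge> L / 2"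
    and lnM: "ln M \<ge> 4 * E" "ln M \<ge> 1" "ln M \<le> L / 2"
begin

abbreviation "F t \<equiv> (cmod (exp_sum (indicator (smooth_numbers y)) N t))\<^sup>2"

text \<open>The order of magnitude of the number of non-smooth integers up to \<open>N\<close>, and
  at least half of \<open>N * ln u\<close>.\<close>

definition "Z = real N * ln M / L"

lemma N_pos: "real N > 1" using N by simp

lemma M_pos: "M > 0" using y N_pos by (simp add: M_def)

lemma powr_mult_N: "real N powr s * real N powr t = real N powr (s + t)"
  by (simp add: powr_add)

lemma powr_mono_N: "s \<le> t \<Longrightarrow> real N powr s \<le> real N powr t"
  using N_pos by (simp add: powr_mono)

lemma powr_one_N: "real N powr 1 = real N" using N_pos by simp

lemma ln_powr_N: "ln (real N powr s) = s * L" using N_pos by (simp add: ln_powr L_def)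

lemma H_gt_1: "H > 1" using H(1) L(1) by linarith

lemma Z_pos: "Z > 0" using N_pos lnM L by (simp add: Z_def)

lemma sqrt_le_y: "real N powr (1 / 2) \<le> y"
proof -
  have "ln (real N powr (1 / 2)) \<le> ln y" unfolding ln_powr_N using y by simp
  then show ?thesis using y N_pos by (subst (asm) ln_le_cancel_iff) auto
qed

lemma N_le_y_sq: "real N \<le> y\<^sup>2"
proof -
  have "real N = real N powr (1 / 2) * real N powr (1 / 2)"
    unfolding powr_mult_N using N_pos by simp
  also have "\<dots> \<le> y * y" using sqrt_le_y y by (intro mult_mono) auto
  finally show ?thesis by (simp add: power2_eq_square)
qed

lemma y_le_N: "y \<le> real N"
proof -
  have "M \<ge> 1" using lnM(2) ln_less_zero_iff[OF M_pos] by linarith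
  then show ?thesis using y by (simp add: M_def pos_le_divide_eq)
qed

text \<open>The left side counts the non-smooth integers up to \<open>N\<close>. The constant 3
  arises from \<open>E \<le> ln M / 2\<close> and \<open>ln y \<ge> L / 2\<close>.\<close>

lemma sum_large_primes_le: "(\<Sum>p\<in>large_primes N y. real (N div p)) \<le> 3 * Z"
proof -
  have "(\<Sum>p\<in>large_primes N y. real (N div p)) \<le> (\<Sum>p\<in>large_primes N y. real N * (1 / real p))"
    by (intro sum_mono) (simp add: of_nat_div_le_of_nat)
  also have "\<dots> = real N * (\<Sum>p\<in>large_primes N y. 1 / real p)" by (simp only: sum_distrib_left)
  also have "\<dots> \<le> real N * ((\<Sum>p\<in>large_primes N y. ln (real p) / real p) / ln y)"
    using y by (intro mult_left_mono sum_inverse_primes_le) (auto simp: large_primes_def)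
  also have "\<dots> \<le> real N * ((ln M + E) / (L / 2))"
  proof (intro mult_left_mono frac_le)
    show "(\<Sum>p\<in>large_primes N y. ln (real p) / real p) \<le> ln M + E"
      using mertens[of y "real N"] y y_le_N unfolding large_primes_def M_def by (simp add: abs_le_iff)
  qed (use lnM E_pos y L in auto)
  also have "\<dots> \<le> real N * ((3 / 2 * ln M) / (L / 2))"
    using lnM L by (intro mult_left_mono divide_right_mono) auto
  also have "\<dots> = 3 * Z" by (simp add: Z_def)
  finally show ?thesis .
qed

text \<open>Only primes above \<open>N powr (3/4)\<close> are kept: there
  \<open>N div p < l\<close>, so the remainder is \<open>N div p\<close> itself, which is at least
  \<open>N / (2 * p)\<close>. Mertens' theorem bounds the remaining sum of \<open>1 / p\<close> from
  below.\<close>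

lemma sum_large_primes_mod_ge:
  assumes l: "real N powr (1 / 4) \<le> real l"
  shows "(\<Sum>p\<in>large_primes N y. real ((N div p) mod l)) \<ge> Z / 8"
proof -
  define T where "T = real N powr (3 / 4)"
  define z where "z = max y T"
  have T: "T * real N powr (1 / 4) = real N" "T > 0" "ln T = 3 / 4 * L"
    unfolding T_def powr_mult_N using N_pos by (simp_all add: ln_powr L_def)
  have "T \<le> real N" using powr_mono_N[of "3 / 4" 1] N_pos by (simp add: T_def)
  then have z: "z > 1" "z \<le> real N" "y \<le> z" "T \<le> z" using y y_le_N by (auto simp: z_def)
  have "ln (real N / z) \<ge> ln M / 2"
  proof (cases "T \<le> y")
    case True
    then show ?thesis using lnM by (simp add: z_def M_def)
  next
    case False
    have "ln (real N / T) = L / 4" using T N_pos by (simp add: ln_div L_def)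
    then show ?thesis using False lnM by (simp add: z_def)
  qed
  then have lnz: "ln (real N / z) - E \<ge> ln M / 4" using lnM by linarith
  let ?A = "{p. prime p \<and> z < real p \<and> real p \<le> real N}"
  have fA: "finite ?A" by (rule finite_primes_real)
  have "Z / 8 = real N / 2 * ((ln M / 4) / L)" by (simp add: Z_def)
  also have "\<dots> \<le> real N / 2 * ((\<Sum>p\<in>?A. ln (real p) / real p) / L)"
  proof (intro mult_left_mono divide_right_mono)
    show "ln M / 4 \<le> (\<Sum>p\<in>?A. ln (real p) / real p)"
      using mertens[of z "real N"] z lnz unfolding abs_le_iff by linarith
  qed (use L in auto)
  also have "\<dots> \<le> real N / 2 * (\<Sum>p\<in>?A. 1 / real p)"
    unfolding L_def using N_pos by (intro mult_left_mono sum_inverse_primes_ge) auto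
  also have "\<dots> = (\<Sum>p\<in>?A. real N / 2 * (1 / real p))" by (rule sum_distrib_left)
  also have "\<dots> \<le> (\<Sum>p\<in>?A. real ((N div p) mod l))"
  proof (rule sum_mono)
    fix p assume p: "p \<in> ?A"
    then have pp: "p > 0" "p \<le> N" "T < real p" using z by (auto simp: prime_gt_0_nat)
    have "real N < real p * real l"
    proof -
      have "real N = T * real N powr (1 / 4)" using T by simp
      also have "\<dots> \<le> T * real l" using l T by (intro mult_left_mono) auto
      also have "\<dots> < real p * real l"
      proof (rule mult_strict_right_mono)
        have "0 < real N powr (1 / 4)" using N_pos by simp
        then show "0 < real l" using l by linarith
      qed (use pp in simp)
      finally show ?thesis .
    qed
    then have "N < l * p" by (simp only: of_nat_mult[symmetric] of_nat_less_iff mult.commute)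
    then have "N div p < l" by (rule less_mult_imp_div_less)
    then have "(N div p) mod l = N div p" by simp
    moreover have "N \<le> 2 * (N div p) * p"
    proof -
      have "N < N div p * p + p" using dividend_less_div_times[of p N] pp by simp
      moreover have "1 \<le> N div p" using pp by (simp add: Suc_le_eq div_greater_zero_iff)
      then have "1 * p \<le> N div p * p" by (rule mult_le_mono1)
      ultimately show ?thesis by (simp only: mult.assoc)
    qed
    then have "real N \<le> 2 * real (N div p) * real p" using of_nat_mono by fastforce
    ultimately show "real N / 2 * (1 / real p) \<le> real ((N div p) mod l)"
      using pp by (simp add: pos_divide_le_eq)
  qed
  also have "\<dots> \<le> (\<Sum>p\<in>large_primes N y. real ((N div p) mod l))"
    using z by (intro sum_mono2) (auto simp: large_primes_def)
  finally show ?thesis .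
qed

text \<open>The cap at \<open>N powr (1/8)\<close> keeps the complementary prime \<open>l\<close>
  above \<open>N powr (1/4)\<close>. Hence \<open>l > r\<close>, which makes the factorisation
  \<open>r * l\<close> recoverable, and \<open>N div p < l\<close> for every
  \<open>p > N powr (3/4)\<close>.\<close>

definition "R = rough_squarefree M (real N powr (1 / 8))"

text \<open>The lower end places \<open>r * l\<close> above \<open>K * Q\<^sub>0\<close>; the upper
  end makes \<open>2 * (r * l) ^ 2\<close> negligible against \<open>Z\<close>.\<close>

definition "P r = {l::nat. prime l \<and> real N powr (1 / 2 - \<delta> / 2) / real r < real l
   \<and> real l \<le> real N powr (1 / 2 - \<delta> / 4) / real r}"

lemma finite_R [simp]: "finite R" by (simp add: R_def)

lemma finite_P [simp]: "finite (P r)" unfolding P_def by (rule finite_primes_real)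

lemma pair_bounds:
  assumes "r \<in> R" "l \<in> P r"
  shows "0 < r" "squarefree r" "prime l" "\<not> l dvd r" "real r \<le> y" "real l \<le> y"
    and "\<And>p. prime p \<Longrightarrow> p dvd r \<Longrightarrow> real N / y < real p"
    and "real N powr (1 / 4) \<le> real l" "r < l"
    and "real N powr (1 / 2 - \<delta> / 2) < real (r * l)" "real (r * l) \<le> real N powr (1 / 2 - \<delta> / 4)"
proof -
  show r: "0 < r" "squarefree r" "\<And>p. prime p \<Longrightarrow> p dvd r \<Longrightarrow> real N / y < real p"
    using assms(1) unfolding M_def[symmetric] R_def rough_squarefree_def by auto
  have r_le: "real r \<le> real N powr (1 / 8)" using assms(1) unfolding R_def rough_squarefree_def by auto
  show "prime l" using assms(2) unfolding P_def by auto
  show q: "real N powr (1 / 2 - \<delta> / 2) < real (r * l)" "real (r * l) \<le> real N powr (1 / 2 - \<delta> / 4)"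
    using assms(2) r(1) unfolding P_def by (auto simp: field_simps)
  have "real N powr (1 / 2 - \<delta> / 2 - 1 / 8) * real r \<le> real N powr (1 / 2 - \<delta> / 2 - 1 / 8) * real N powr (1 / 8)"
    using r_le by (intro mult_left_mono) auto
  also have "\<dots> = real N powr (1 / 2 - \<delta> / 2)" unfolding powr_mult_N by simp
  also have "\<dots> < real l * real r" using q(1) by (simp add: mult.commute)
  finally have "real N powr (1 / 2 - \<delta> / 2 - 1 / 8) < real l" using r(1) by simp
  moreover have "real N powr (1 / 4) \<le> real N powr (1 / 2 - \<delta> / 2 - 1 / 8)" using \<delta> by (intro powr_mono_N) simp
  ultimately show l: "real N powr (1 / 4) \<le> real l" by linarith
  have "real N powr (1 / 8) < real N powr (1 / 4)" using N_pos by simp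
  then show "r < l" using r_le l by linarith
  then show "\<not> l dvd r" using r(1) by (auto dest: dvd_imp_le)
  have "real l \<le> real (r * l)" using r(1) by (intro of_nat_mono) simp
  also have "\<dots> \<le> real N powr (1 / 2)" using q(2) powr_mono_N[of "1 / 2 - \<delta> / 4" "1 / 2"] \<delta> by linarith
  finally show "real l \<le> y" using sqrt_le_y by linarith
  then show "real r \<le> y" using \<open>r < l\<close> by linarith
qed

text \<open>The budget behind 4096: the main term is at least \<open>Z / 8\<close>, the shift costs
  at most \<open>16 / 4096 * 3 * Z = 3 * Z / 256\<close>, and the full sum at most
  \<open>Z / 64\<close>. What remains exceeds \<open>Z / 16\<close>.\<close>

lemma sum_totatives_F_ge:
  assumes "r \<in> R" "l \<in> P r" "\<bar>b\<bar> \<le> 1 / (4096 * real N)"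
  shows "(\<Sum>a\<in>totatives (r * l). F (real a / real (r * l) + b)) \<ge> (Z / 16)\<^sup>2 / real (r * l)"
proof (rule sum_totatives_cmod_sq_ge)
  note pb = pair_bounds[OF assms(1,2)]
  show "squarefree r" "\<And>p. prime p \<Longrightarrow> p dvd r \<Longrightarrow> real N / y < real p" "0 < r" "real r \<le> y"
    "prime l" "\<not> l dvd r" "real l \<le> y" by (fact pb)+
  show "0 < y" "real N \<le> y\<^sup>2" using y N_le_y_sq by auto
  show "0 \<le> Z / 16" using Z_pos by simp
  have qN: "real (r * l) \<le> real N"
    using pb(11) powr_mono_N[of "1 / 2 - \<delta> / 4" 1] \<delta> unfolding powr_one_N by linarith
  have qpos: "real (r * l) > 0" using pb(1) prime_gt_0_nat[OF pb(3)] by simp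
  have "1 / (4096 * real N) \<le> 1 / (2 * real (r * l))"
    using qN qpos by (intro divide_left_mono mult_pos_pos mult_mono) auto
  then show "\<bar>b\<bar> \<le> 1 / (2 * real (r * l))" using assms(3) by linarith
  have "real N * \<bar>b\<bar> \<le> 1 / 4096"
    using mult_left_mono[OF assms(3), of "real N"] N_pos by simp
  moreover have "4 * pi \<le> 16" using pi_less_4 by simp
  ultimately have "4 * pi * (real N * \<bar>b\<bar>) \<le> 16 * (1 / 4096)"
    by (intro mult_mono[of "4 * pi"]) simp_all
  then have "4 * pi * (real N * \<bar>b\<bar>) * (\<Sum>p\<in>large_primes N y. real (N div p)) \<le> 16 * (1 / 4096) * (3 * Z)"
    by (rule mult_mono[OF _ sum_large_primes_le]) (simp_all add: sum_nonneg)
  moreover have "2 * (real (r * l))\<^sup>2 \<le> Z / 64"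
  proof -
    have "(real (r * l))\<^sup>2 \<le> (real N powr (1 / 2 - \<delta> / 4))\<^sup>2" using pb(11) by (intro power_mono) auto
    also have "\<dots> = real N powr (1 - \<delta> / 2)" unfolding power2_eq_square powr_mult_N by simp
    finally have "(real (r * l))\<^sup>2 * H \<le> real N powr (1 - \<delta> / 2) * H"
      using H_gt_1 by (intro mult_right_mono) auto
    also have "\<dots> = real N" unfolding H_def powr_mult_N using N_pos by simp
    finally have "(real (r * l))\<^sup>2 * (128 * L) \<le> real N"
      using mult_left_mono[OF H(1), of "(real (r * l))\<^sup>2"] by simp
    also have "\<dots> \<le> real N * ln M" using lnM(2) N_pos mult_left_mono[OF lnM(2), of "real N"] by simp
    finally show ?thesis using L(1) by (simp add: Z_def pos_le_divide_eq)
  qed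
  moreover have "Z / 8 \<le> (\<Sum>p\<in>large_primes N y. real ((N div p) mod l))"
    by (rule sum_large_primes_mod_ge[OF pb(8)])
  ultimately show "Z / 16 \<le> (\<Sum>p\<in>large_primes N y. real ((N div p) mod l))
       - 4 * pi * (real N * \<bar>b\<bar>) * (\<Sum>p\<in>large_primes N y. real (N div p)) - 2 * (real (r * l))\<^sup>2"
    using Z_pos by linarith
qed

text \<open>The range of \<open>l\<close> has logarithmic length \<open>\<delta> / 4 * L\<close> for
  every \<open>r\<close>. Half of it absorbs the Mertens error, and dividing by
  \<open>ln l \<le> L\<close> leaves a bound uniform in \<open>r\<close>.\<close>

lemma sum_inverse_P_ge:
  assumes "r \<in> R"
  shows "(\<Sum>l\<in>P r. 1 / real l) \<ge> \<delta> / 8"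
proof -
  have r: "0 < r" "real r \<le> real N powr (1 / 8)"
    using assms unfolding R_def rough_squarefree_def by auto
  define a b where "a = real N powr (1 / 2 - \<delta> / 2) / real r" "b = real N powr (1 / 2 - \<delta> / 4) / real r"
  have "real r \<le> real N powr (1 / 2 - \<delta> / 2)"
    using r(2) powr_mono_N[of "1 / 8" "1 / 2 - \<delta> / 2"] \<delta> by linarith
  then have a: "1 \<le> a" using r(1) by (simp add: a_b_def)
  have ab: "a \<le> b" unfolding a_b_def using \<delta> by (intro divide_right_mono powr_mono_N) auto
  have "b \<le> real N powr (1 / 2 - \<delta> / 4) / 1" unfolding a_b_def using r(1) by (intro divide_left_mono) auto
  then have bN: "b \<le> real N" using powr_mono_N[of "1 / 2 - \<delta> / 4" 1] \<delta> unfolding powr_one_N by simp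
  have "b / a = real N powr (1 / 2 - \<delta> / 4) / real N powr (1 / 2 - \<delta> / 2)"
    using r(1) by (simp add: a_b_def)
  also have "\<dots> = real N powr (\<delta> / 4)" by (simp add: powr_diff[symmetric])
  finally have "ln (b / a) = \<delta> / 4 * L" by (simp only: ln_powr_N)
  then have "\<delta> / 4 * L - E \<le> (\<Sum>l\<in>P r. ln (real l) / real l)"
    using mertens[OF a ab] unfolding P_def a_b_def[symmetric] abs_le_iff by linarith
  moreover have "E \<le> \<delta> / 8 * L" using L(2) \<delta> by (simp add: field_simps)
  moreover have "\<delta> / 4 * L = 2 * (\<delta> / 8 * L)" by simp
  ultimately have "\<delta> / 8 * L \<le> (\<Sum>l\<in>P r. ln (real l) / real l)" by linarith
  then have "\<delta> / 8 \<le> (\<Sum>l\<in>P r. ln (real l) / real l) / L" using L(1) by (simp add: pos_le_divide_eq)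
  also have "\<dots> \<le> (\<Sum>l\<in>P r. 1 / real l)"
    unfolding L_def using N_pos bN by (intro sum_inverse_primes_ge) (auto simp: P_def a_b_def)
  finally show ?thesis .
qed

lemma sum_inverse_R_ge: "(\<Sum>r\<in>R. 1 / real r) \<ge> c * L / (8 * ln M)"
proof -
  have "real N powr 0 \<le> real N powr (1 / 8)" by (intro powr_mono_N) simp
  then show ?thesis
    using rough[OF M_pos lnM(2), of "real N powr (1 / 8)"] N_pos unfolding R_def ln_powr_N by simp
qed

section \<open>Spacing of the fractions and their position relative to the major arcs\<close>

definition "pairs = (SIGMA r:R. P r)"

definition "triples = (SIGMA z:pairs. totatives (fst z * snd z))"

definition "center = (\<lambda>(z, a). real a / real (fst z * snd z))"

lemma finite_triples [simp]: "finite triples"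
  by (simp add: triples_def pairs_def)

lemma triple_props:
  assumes "((r, l), a) \<in> triples"
  shows "r \<in> R" "l \<in> P r" "a \<in> totatives (r * l)" "coprime (int a) (int (r * l))" "r * l > 0" "0 < a" "a < r * l"
proof -
  show *: "r \<in> R" "l \<in> P r" "a \<in> totatives (r * l)" using assms by (auto simp: triples_def pairs_def)
  note pb = pair_bounds[OF *(1,2)]
  have "r * l \<ge> 1 * 2" using pb(1) prime_ge_2_nat[OF pb(3)] by (intro mult_le_mono) auto
  then show "a < r * l" "r * l > 0" using totatives_less[OF *(3)] by linarith+
  show "coprime (int a) (int (r * l))" "0 < a" using *(3) by (auto simp: in_totatives_iff simp del: of_nat_mult)
qed

text \<open>Distinct triples give distinct reduced fractions, because \<open>l\<close> is the only
  prime factor of \<open>r * l\<close> exceeding its cofactor. The denominators are at most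
  \<open>N powr (1/2)\<close>, which gives the spacing \<open>1 / N\<close>.\<close>

lemma center_distance:
  assumes "x \<in> triples" "x' \<in> triples" "x \<noteq> x'"
  shows "\<bar>center x - center x'\<bar> \<ge> 1 / real N"
proof -
  obtain r l a where x: "x = ((r, l), a)" by (metis prod.exhaust)
  obtain r' l' a' where x': "x' = ((r', l'), a')" by (metis prod.exhaust)
  note t = triple_props[OF assms(1)[unfolded x]] and t' = triple_props[OF assms(2)[unfolded x']]
  note pb = pair_bounds[OF t(1,2)] and pb' = pair_bounds[OF t'(1,2)]
  have "(int a, r * l) \<noteq> (int a', r' * l')"
  proof
    assume "(int a, r * l) = (int a', r' * l')"
    then have eq: "a = a'" "r * l = r' * l'" by auto
    \<comment> \<open>Otherwise \<open>l \<le> r' < l'\<close>, and the prime \<open>l'\<close>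
      would divide \<open>r * l\<close> although both factors are smaller than
      \<open>l'\<close>.\<close>
    have "\<not> l dvd r'"
    proof
      assume "l dvd r'"
      then have "l \<le> r'" using pb'(1) by (simp add: dvd_imp_le)
      then have "l < l'" using pb'(9) by simp
      then have "\<not> l' dvd l" using prime_gt_0_nat[OF pb(3)] by (auto dest: dvd_imp_le)
      moreover have "\<not> l' dvd r" using \<open>l < l'\<close> pb(1,9) by (auto dest: dvd_imp_le)
      ultimately show False using eq(2) prime_dvd_multD[OF pb'(3), of r l] dvd_triv_right[of l' r'] by simp
    qed
    then have "l dvd l'" using eq(2) prime_dvd_multD[OF pb(3), of r' l'] dvd_triv_right[of l r] by simp
    then have "l = l'" using primes_dvd_imp_eq pb(3) pb'(3) by blast
    then show False using eq assms(3) prime_gt_0_nat[OF pb(3)] by (simp add: x x')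
  qed
  then have "1 / (real (r * l) * real (r' * l')) \<le> \<bar>center x - center x'\<bar>"
    using fraction_distance_ge[OF t(4) t'(4) t(5) t'(5)] by (simp add: center_def x x')
  moreover have "real (r * l) * real (r' * l') \<le> real N powr (1 / 2) * real N powr (1 / 2)"
    using pb(11) pb'(11) powr_mono_N[of "1 / 2 - \<delta> / 4" "1 / 2"] \<delta> by (intro mult_mono) auto
  then have "real (r * l) * real (r' * l') \<le> real N" unfolding powr_mult_N using N_pos by simp
  then have "1 / real N \<le> 1 / (real (r * l) * real (r' * l'))"
    using t(5) t'(5) N by (intro divide_left_mono mult_pos_pos) auto
  ultimately show ?thesis by linarith
qed

text \<open>The power \<open>L ^ 17\<close> is below \<open>H = N powr (\<delta> / 2)\<close>, so it
  costs half of the saving \<delta> in the exponent.\<close>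

lemma K_Q0_le: "K * Q\<^sub>0 \<le> real N powr (1 / 2 - \<delta> / 2)"
proof -
  have "K * Q\<^sub>0 \<le> real N powr (1 / 2 - \<delta>) * H"
    using Q0 mult_left_mono[OF less_imp_le[OF H(2)], of "real N powr (1 / 2 - \<delta>)"] by simp
  then show ?thesis unfolding H_def powr_mult_N by (simp add: algebra_simps)
qed

lemma Q_pos: "Q > 0"
proof -
  have "0 < real N powr (1 / 2 + \<delta>)" using N_pos by simp
  then show ?thesis using Q(1) by linarith
qed

text \<open>A major denominator \<open>q'\<close> is smaller than \<open>q\<close>, so the two
  fractions differ by at least \<open>1 / (q * q')\<close>. After multiplication by
  \<open>q * q'\<close> the two radii amount to at most \<open>1/4096\<close> and
  \<open>K * q / Q \<le> 1/8\<close>, too little to bridge that gap.\<close>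

lemma center_ball_minor:
  assumes "x \<in> triples"
  shows "{center x - 1 / (4096 * real N)..center x + 1 / (4096 * real N)} \<subseteq> minor_arcs K Q\<^sub>0 Q"
proof
  fix t assume t: "t \<in> {center x - 1 / (4096 * real N)..center x + 1 / (4096 * real N)}"
  obtain r l a where x: "x = ((r, l), a)" by (metis prod.exhaust)
  define q where "q = r * l"
  note tp = triple_props[OF assms(1)[unfolded x], folded q_def]
  note pb = pair_bounds[OF tp(1,2), folded q_def]
  have cx: "center x = real a / real q" by (simp add: center_def x q_def)
  define h where "h = 1 / (4096 * real N)"
  have q0: "real q > 0" using tp by simp
  have q_half: "real q \<le> real N powr (1 / 2)"
    using pb(11) powr_mono_N[of "1 / 2 - \<delta> / 4" "1 / 2"] \<delta> by linarith
  have "real q * real q \<le> real N powr (1 / 2) * real N powr (1 / 2)"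
    using q_half by (intro mult_mono) auto
  then have qq: "real q * real q \<le> real N" unfolding powr_mult_N using N_pos by simp
  have h: "h > 0" "h * (real q * real q) \<le> 1 / 4096"
    using qq N_pos by (simp_all add: h_def pos_divide_le_eq)
  have q1: "real q \<ge> 1" using tp by simp
  have "h * real q \<le> h * (real q * real q)" using q1 h by (intro mult_left_mono) auto
  then have hq: "h * real q < 1" using h by linarith
  then have hq': "h < 1 / real q" using q0 by (simp add: pos_less_divide_eq)
  have "1 / real q \<le> real a / real q" using tp by (intro divide_right_mono) auto
  moreover have "real a / real q \<le> (real q - 1) / real q" using tp by (intro divide_right_mono) auto
  moreover have "(real q - 1) / real q = 1 - 1 / real q" using q0 by (simp add: field_simps)
  ultimately have t01: "t \<in> {0..<1}" using t hq' unfolding cx h_def[symmetric] by auto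
  have "t \<notin> major_arcs K Q\<^sub>0 Q"
  proof
    assume "t \<in> major_arcs K Q\<^sub>0 Q"
    then obtain q' a' where *: "0 < q'" "real q' \<le> K * Q\<^sub>0" "coprime a' (int q')"
      "\<bar>t - real_of_int a' / real q'\<bar> \<le> K / (real q' * Q)" unfolding major_arcs_def by blast
    have "real q' < real q" using *(2) K_Q0_le pb(10) by linarith
    then have "(int a, q) \<noteq> (a', q')" by auto
    from fraction_distance_ge[OF tp(4) *(3) tp(5) *(1) this]
    have "1 / (real q * real q') \<le> h + K / (real q' * Q)"
      using t *(4) unfolding cx h_def[symmetric] by (simp add: abs_le_iff) linarith
    then have "1 / (real q * real q') * (real q * real q') \<le> (h + K / (real q' * Q)) * (real q * real q')"
      by (intro mult_right_mono) auto
    also have "\<dots> = h * (real q * real q') + K * real q / Q"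
      using *(1) Q_pos by (simp add: field_simps)
    also have "h * (real q * real q') \<le> h * (real q * real q)"
      using \<open>real q' < real q\<close> h by (intro mult_left_mono) auto
    also have "\<dots> \<le> 1 / 4096" by (rule h)
    finally have "1 \<le> 1 / 4096 + K * real q / Q" using q0 *(1) by simp
    moreover have "K * real q / Q \<le> 1 / 8"
    proof -
      have "K * real q * 8 \<le> H * real N powr (1 / 2)"
        using mult_mono[OF less_imp_le[OF H(3)] q_half] H_gt_1 by (simp add: mult_ac)
      also have "\<dots> \<le> real N powr (1 / 2 + \<delta>)"
        unfolding H_def powr_mult_N using \<delta> by (intro powr_mono_N) simp
      also have "\<dots> \<le> Q" by (rule Q)
      finally show ?thesis using Q_pos by (simp add: pos_divide_le_eq)
    qed
    ultimately show False by simp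
  qed
  then show "t \<in> minor_arcs K Q\<^sub>0 Q" using t01 by (simp add: minor_arcs_def)
qed

lemma minor_arcs_Icc: "minor_arcs K Q\<^sub>0 Q \<subseteq> {0..1}"
  by (auto simp: minor_arcs_def)

lemma minor_integral_ge_smooth:
  "(LINT t:minor_arcs K Q\<^sub>0 Q|lborel. F t) \<ge> c * \<delta> / 2 ^ 25 * Z"
proof -
  define h where "h = 1 / (4096 * real N)"
  have h: "h > 0" "2 * h < 1 / real N" using N_pos by (auto simp: h_def field_simps)
  have inj: "inj_on center triples"
  proof (rule inj_onI)
    fix x x' assume *: "x \<in> triples" "x' \<in> triples" "center x = center x'"
    show "x = x'"
    proof (rule ccontr)
      assume "x \<noteq> x'"
      from center_distance[OF *(1,2) this] show False using *(3) N_pos by simp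
    qed
  qed
  define W where "W = (Z / 16)\<^sup>2 * (\<delta> / 8 * (c * L / (8 * ln M)))"
  have "2 * h * W \<le> (LINT t:minor_arcs K Q\<^sub>0 Q|lborel. F t)"
  proof (rule arcs_integral_ge[where X = "center ` triples" and a = 0 and b = 1])
    show "disjoint_family_on (\<lambda>x. {x - h..x + h}) (center ` triples)"
      unfolding disjoint_family_on_def
    proof (intro ballI impI)
      fix u v assume uv: "u \<in> center ` triples" "v \<in> center ` triples" "u \<noteq> v"
      then obtain x x' where "u = center x" "v = center x'" "x \<in> triples" "x' \<in> triples" "x \<noteq> x'" by blast
      then have "1 / real N \<le> \<bar>u - v\<bar>" using center_distance by blast
      then show "{u - h..u + h} \<inter> {v - h..v + h} = {}" using h(2) by auto
    qed
    show "W \<le> (\<Sum>x\<in>center ` triples. F (x + t))" if "\<bar>t\<bar> \<le> h" for t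
    proof -
      have "W \<le> (Z / 16)\<^sup>2 * (\<Sum>r\<in>R. 1 / real r * (\<Sum>l\<in>P r. 1 / real l))"
        unfolding W_def
      proof (rule mult_left_mono)
        have "\<delta> / 8 * (c * L / (8 * ln M)) \<le> \<delta> / 8 * (\<Sum>r\<in>R. 1 / real r)"
          using sum_inverse_R_ge \<delta> by (intro mult_left_mono) auto
        also have "\<dots> = (\<Sum>r\<in>R. 1 / real r * (\<delta> / 8))" by (simp add: sum_distrib_left mult.commute)
        also have "\<dots> \<le> (\<Sum>r\<in>R. 1 / real r * (\<Sum>l\<in>P r. 1 / real l))"
          using sum_inverse_P_ge by (intro sum_mono mult_left_mono) auto
        finally show "\<delta> / 8 * (c * L / (8 * ln M)) \<le> (\<Sum>r\<in>R. 1 / real r * (\<Sum>l\<in>P r. 1 / real l))" .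
      qed simp
      also have "\<dots> = (\<Sum>r\<in>R. \<Sum>l\<in>P r. (Z / 16)\<^sup>2 / real (r * l))"
        by (simp add: sum_distrib_left)
      also have "\<dots> \<le> (\<Sum>r\<in>R. \<Sum>l\<in>P r. \<Sum>a\<in>totatives (r * l). F (real a / real (r * l) + t))"
        using that unfolding h_def by (intro sum_mono sum_totatives_F_ge)
      also have "\<dots> = (\<Sum>x\<in>triples. F (center x + t))"
      proof -
        let ?G = "\<lambda>z. \<Sum>a\<in>totatives (fst z * snd z). F (center (z, a) + t)"
        have "(\<Sum>r\<in>R. \<Sum>l\<in>P r. ?G (r, l)) = (\<Sum>z\<in>pairs. ?G z)"
          unfolding pairs_def by (subst sum.Sigma) (simp_all add: case_prod_beta)
        also have "\<dots> = (\<Sum>x\<in>triples. F (center x + t))"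
          unfolding triples_def by (subst sum.Sigma) (simp_all add: case_prod_beta pairs_def)
        finally show ?thesis by (simp add: center_def)
      qed
      also have "\<dots> = (\<Sum>x\<in>center ` triples. F (x + t))" by (simp add: sum.reindex[OF inj])
      finally show ?thesis .
    qed
  qed (use h center_ball_minor minor_arcs_Icc in \<open>auto simp: h_def continuous_cmod_exp_sum_sq\<close>)
  \<comment> \<open>The powers of 2 are 11 from \<open>2 * h\<close>, 8 from the square and 6 from
    the two eighths. The identity \<open>Z ^ 2 * L / (N * ln M) = Z\<close> restores a bound linear
    in the density.\<close>
  moreover have "2 * h * W = c * \<delta> / 2 ^ 25 * Z"
    using N_pos lnM(2) L(1) by (simp add: h_def W_def Z_def power2_eq_square field_simps)
  ultimately show ?thesis by simp
qed

text \<open>Major arcs have radius at most \<open>K / Q\<close>. Centres at or below 0 are at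
  distance at least \<open>2 * K / Q\<close>, and positive centres are at least
  \<open>1 / q \<ge> 8 * K / Q\<close>, far to the right of \<open>3 * K / Q\<close>.\<close>

lemma near_zero_minor: "{2 * K / Q..3 * K / Q} \<subseteq> minor_arcs K Q\<^sub>0 Q"
proof
  fix t assume t: "t \<in> {2 * K / Q..3 * K / Q}"
  have KQ: "K / Q > 0" using K Q_pos by simp
  have tK: "2 * (K / Q) \<le> t" "t \<le> 3 * (K / Q)" using t by auto
  have "8 * K * real N powr (1 / 2) \<le> H * real N powr (1 / 2)"
    using H by (intro mult_right_mono) auto
  also have "\<dots> \<le> real N powr (1 / 2 + \<delta>)" unfolding H_def powr_mult_N using \<delta> by (intro powr_mono_N) simp
  finally have "8 * K * real N powr (1 / 2) \<le> Q" using Q by linarith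
  then have half: "8 * (K / Q) * real N powr (1 / 2) \<le> 1" using Q_pos by (simp add: field_simps)
  have "real N powr 0 \<le> real N powr (1 / 2)" by (intro powr_mono_N) simp
  then have "1 \<le> real N powr (1 / 2)" using N_pos by simp
  then have "8 * (K / Q) * 1 \<le> 8 * (K / Q) * real N powr (1 / 2)" using KQ by (intro mult_left_mono) auto
  then have KQ8: "8 * (K / Q) \<le> 1" using half by simp
  have "t \<notin> major_arcs K Q\<^sub>0 Q"
  proof
    assume "t \<in> major_arcs K Q\<^sub>0 Q"
    then obtain q a where *: "0 < q" "real q \<le> K * Q\<^sub>0" "coprime a (int q)"
      "\<bar>t - real_of_int a / real q\<bar> \<le> K / (real q * Q)" unfolding major_arcs_def by blast
    have q1: "real q \<ge> 1" using *(1) by simp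
    have "K / (real q * Q) \<le> K / (1 * Q)" using q1 K Q_pos by (intro divide_left_mono mult_right_mono) auto
    then have near: "\<bar>t - real_of_int a / real q\<bar> \<le> K / Q" using *(4) by simp
    show False
    proof (cases "a \<le> 0")
      case True
      then have "real_of_int a / real q \<le> 0" using q1 by (simp add: divide_nonpos_pos)
      then show False using near tK KQ unfolding abs_le_iff by linarith
    next
      case False
      have "real q \<le> real N powr (1 / 2)"
        using *(2) K_Q0_le powr_mono_N[of "1 / 2 - \<delta> / 2" "1 / 2"] \<delta> by linarith
      then have "8 * (K / Q) * real q \<le> 8 * (K / Q) * real N powr (1 / 2)" using KQ by (intro mult_left_mono) auto
      then have "8 * (K / Q) * real q \<le> 1" using half by linarith
      then have "8 * (K / Q) \<le> 1 / real q" using q1 by (simp add: pos_le_divide_eq)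
      also have "\<dots> \<le> real_of_int a / real q" using False q1 by (intro divide_right_mono) auto
      finally show False using near tK KQ unfolding abs_le_iff by linarith
    qed
  qed
  moreover have "t \<in> {0..<1}" using tK KQ KQ8 by auto
  ultimately show "t \<in> minor_arcs K Q\<^sub>0 Q" by (simp add: minor_arcs_def)
qed

text \<open>The smooth indicator is 1 minus the non-smooth one. The comparison of squares halves the
  Dirichlet kernel integral, and Parseval charges the number of non-smooth integers, at most
  \<open>3 * Z\<close>.\<close>

lemma minor_integral_ge_Q:
  "(LINT t:minor_arcs K Q\<^sub>0 Q|lborel. F t) \<ge> Q / (72 * pi\<^sup>2 * K) - 3 * Z"
proof -
  define g :: "nat \<Rightarrow> real" where "g n = (if n \<in> smooth_numbers y then 0 else 1)" for n
  have eq: "(\<lambda>n. 1 - of_real (g n)) = (indicator (smooth_numbers y) :: nat \<Rightarrow> complex)"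
    by (auto simp: g_def indicator_def)
  have I: "{2 * K / Q..3 * K / Q} \<subseteq> {0..1}" using near_zero_minor minor_arcs_Icc by blast
  have "(\<Sum>n=1..N. (g n)\<^sup>2) = (\<Sum>n\<in>{1..N} - smooth_numbers y. 1)"
    by (rule sum.mono_neutral_cong_right) (auto simp: g_def)
  also have "\<dots> = (\<Sum>p\<in>large_primes N y. real (N div p))"
    using sum_nonsmooth[OF N_le_y_sq, of "\<lambda>_. 1 :: real"] y by simp
  also have "\<dots> \<le> 3 * Z" by (rule sum_large_primes_le)
  finally have g: "(\<Sum>n=1..N. (g n)\<^sup>2) \<le> 3 * Z" .
  have "Q / (72 * pi\<^sup>2 * K) - 3 * Z = Q / (36 * pi\<^sup>2 * K) / 2 - 3 * Z" by simp
  also have "\<dots> \<le> (LINT t:{2 * K / Q..3 * K / Q}|lborel. (cmod (exp_sum (\<lambda>_. 1) N t))\<^sup>2) / 2 - (\<Sum>n=1..N. (g n)\<^sup>2)"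
    by (intro diff_mono divide_right_mono near_zero_integral_ge[OF K Q_pos Q(2)] g) simp
  also have "\<dots> \<le> (LINT t:{2 * K / Q..3 * K / Q}|lborel. F t)"
    using set_integral_cmod_sq_diff_ge[of "{2 * K / Q..3 * K / Q}" "\<lambda>_. 1" N g] I unfolding eq by simp
  also have "\<dots> \<le> (LINT t:minor_arcs K Q\<^sub>0 Q|lborel. F t)"
    using near_zero_minor minor_arcs_Icc
    by (intro set_integral_mono_subset set_integrable_continuous_subset[of _ _ 0 1] continuous_cmod_exp_sum_sq) auto
  finally show ?thesis .
qed

end

section \<open>Choice of constants and combination of the two lower bounds\<close>

theorem proposition3p5:
  "\<exists>K\<^sub>0>0. \<exists>\<delta>\<^sub>0>0. \<forall>K\<ge>K\<^sub>0. \<forall>\<delta>::real. 0 < \<delta> \<and> \<delta> \<le> \<delta>\<^sub>0 \<longrightarrow>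
    (\<exists>C>0. \<exists>\<kappa>>0. \<exists>N\<^sub>0::nat. \<forall>N\<ge>N\<^sub>0. \<forall>(Q::real) (Q\<^sub>0::real) (y::real) (u::real).
       real N powr (1/2 + \<delta>) \<le> Q \<and>
       K * sqrt (real N * ln (real N)) \<le> Q \<and> Q \<le> real N \<and>
       real N * ln (real N) / Q \<le> Q\<^sub>0 \<and> Q\<^sub>0 \<le> Q / K\<^sup>2 \<and>
       K * Q\<^sub>0 \<le> real N powr (1/2 - \<delta>) * ln (real N) ^ 17 \<and>
       0 < y \<and> u = ln (real N) / ln y \<and>
       1 + ln C / ln (real N) \<le> u \<and> u \<le> 2
       \<longrightarrow> (LINT \<theta>:minor_arcs K Q\<^sub>0 Q|lborel.
              (cmod (exp_sum (indicator (smooth_numbers y)) N \<theta>))\<^sup>2)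
           \<ge> \<kappa> * (real N * ln u + Q))"
proof -
  obtain E where E: "E > 0" and mert: "\<forall>a b. 1 \<le> a \<and> a \<le> b \<longrightarrow>
     \<bar>(\<Sum>p | prime p \<and> a < real p \<and> real p \<le> b. ln (real p) / real p) - ln (b / a)\<bar> \<le> E"
    using mertens_interval by blast
  obtain c where c: "c > 0" and rough: "\<forall>M>0. \<forall>Y. ln M \<ge> 1 \<and> Y \<ge> 1 \<longrightarrow>
     (\<Sum>r\<in>rough_squarefree M Y. 1 / real r) \<ge> c * ln Y / ln M"
    using sum_inverse_rough_ge by blast
  show ?thesis
  proof (rule exI[of _ 1], intro conjI, simp, rule exI[of _ "1 / 8"], intro conjI allI impI, simp)
    fix K \<delta> :: real
    assume K: "K \<ge> 1" and \<delta>: "0 < \<delta> \<and> \<delta> \<le> 1 / 8"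
    \<comment> \<open>Chosen so that \<open>ln M \<ge> ln C / 2 = 4 * E + 1\<close>; it depends on
      neither \<open>K\<close> nor \<delta>.\<close>
    define C where "C = exp (8 * E + 2)"
    define k1 where "k1 = c * \<delta> / 2 ^ 25"
    define k2 where "k2 = 1 / (72 * pi\<^sup>2 * K)"
    \<comment> \<open>The integral \<open>I\<close> satisfies \<open>Z \<le> I / k1\<close> and
      \<open>Q * k2 \<le> I + 3 * Z\<close>. With \<open>N * ln u \<le> 2 * Z\<close>, the two
      summands of \<open>D\<close> bound \<open>N * ln u\<close> and \<open>Q\<close> in units of
      \<open>I\<close>.\<close>
    define D where "D = 2 / k1 + (1 + 3 / k1) / k2"
    have k: "k1 > 0" "k2 > 0" using c \<delta> K by (simp_all add: k1_def k2_def)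
    then have D: "D > 0" unfolding D_def by (intro add_pos_pos divide_pos_pos) auto
    have "eventually (\<lambda>N::nat. N \<ge> 2) sequentially" by (rule eventually_ge_at_top)
    moreover have "eventually (\<lambda>N::nat. ln (real N) \<ge> 1) sequentially" by real_asymp
    moreover have "eventually (\<lambda>N::nat. ln (real N) \<ge> 8 * E / \<delta>) sequentially" by real_asymp
    moreover have "eventually (\<lambda>N::nat. real N powr (\<delta> / 2) \<ge> 128 * ln (real N)) sequentially"
      using \<delta> by real_asymp
    moreover have "eventually (\<lambda>N::nat. real N powr (\<delta> / 2) > ln (real N) ^ 17) sequentially"
      using \<delta> by real_asymp
    moreover have "eventually (\<lambda>N::nat. real N powr (\<delta> / 2) > 8 * K) sequentially"
      using \<delta> by real_asymp
    ultimately have "eventually (\<lambda>N::nat. N \<ge> 2 \<and> ln (real N) \<ge> 1 \<and> ln (real N) \<ge> 8 * E / \<delta>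
        \<and> real N powr (\<delta> / 2) \<ge> 128 * ln (real N) \<and> real N powr (\<delta> / 2) > ln (real N) ^ 17
        \<and> real N powr (\<delta> / 2) > 8 * K) sequentially"
      by eventually_elim blast
    then obtain N\<^sub>0 where N0: "\<And>N. N \<ge> N\<^sub>0 \<Longrightarrow> N \<ge> 2 \<and> ln (real N) \<ge> 1 \<and> ln (real N) \<ge> 8 * E / \<delta>
        \<and> real N powr (\<delta> / 2) \<ge> 128 * ln (real N) \<and> real N powr (\<delta> / 2) > ln (real N) ^ 17
        \<and> real N powr (\<delta> / 2) > 8 * K"
      unfolding eventually_sequentially by blast
    have main: "(LINT \<theta>:minor_arcs K Q\<^sub>0 Q|lborel. (cmod (exp_sum (indicator (smooth_numbers y)) N \<theta>))\<^sup>2)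
        \<ge> 1 / D * (real N * ln u + Q)"
      if N: "N \<ge> N\<^sub>0" and Q: "real N powr (1 / 2 + \<delta>) \<le> Q" "Q \<le> real N"
        and Q0: "K * Q\<^sub>0 \<le> real N powr (1 / 2 - \<delta>) * ln (real N) ^ 17"
        and y: "0 < y" and u: "u = ln (real N) / ln y" "1 + ln C / ln (real N) \<le> u" "u \<le> 2"
      for N Q Q\<^sub>0 y u
    proof -
      note large = N0[OF N]
      define L where "L = ln (real N)"
      define M where "M = real N / y"
      have L: "L \<ge> 1" using large by (simp add: L_def)
      have C: "ln C = 8 * E + 2" by (simp add: C_def)
      have "0 < ln C / L" using C E L by simp
      then have u1: "u > 1" using u(2) by (simp add: L_def)
      \<comment> \<open>For \<open>y \<le> 1\<close> the quotient \<open>u\<close> would be at most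
        0 (and 0 by convention at \<open>y = 1\<close>), contrary to \<open>u > 1\<close>.\<close>
      have lny: "ln y > 0"
      proof (rule ccontr)
        assume "\<not> ln y > 0"
        then have "L / ln y \<le> 0" using L by (simp add: divide_nonneg_nonpos)
        then show False using u1 u(1) by (simp add: L_def)
      qed
      then have y1: "y > 1" using y ln_gt_zero_iff by blast
      have uL: "u * ln y = L" using u(1) lny by (simp add: L_def)
      have "u * ln y \<le> 2 * ln y" using u(3) lny by (intro mult_right_mono) auto
      then have lny2: "ln y \<ge> L / 2" using uL by simp
      have lnM: "ln M = L - ln y" using large y by (simp add: M_def L_def ln_div)
      have lnM': "ln M = (u - 1) * ln y" unfolding lnM using uL by (simp add: algebra_simps)
      \<comment> \<open>The lower bound on \<open>u - 1\<close> and \<open>ln y \<ge> L / 2\<close>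
        multiply to a lower bound for \<open>ln M\<close> in which \<open>L\<close> cancels.\<close>
      have "(ln C / L) * (L / 2) \<le> (u - 1) * ln y"
        using u(2) lny2 \<open>0 < ln C / L\<close> L by (intro mult_mono) (auto simp: L_def)
      then have "ln C / 2 \<le> ln M" unfolding lnM' using L by simp
      then have "4 * E + 1 \<le> ln M" unfolding C by simp
      then have lnM_ge: "ln M \<ge> 4 * E" "ln M \<ge> 1" using E by simp_all
      interpret smooth_minor_arcs E c \<delta> K Q Q\<^sub>0 y M L "real N powr (\<delta> / 2)" N
        by unfold_locales
          (use E c mert rough \<delta> K Q Q0 large y1 lny2 lnM lnM_ge in \<open>simp_all add: L_def M_def\<close>)
      let ?I = "LINT \<theta>:minor_arcs K Q\<^sub>0 Q|lborel. (cmod (exp_sum (indicator (smooth_numbers y)) N \<theta>))\<^sup>2"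
      have Z: "Z \<le> ?I / k1"
        using minor_integral_ge_smooth k unfolding k1_def[symmetric] by (simp add: pos_le_divide_eq mult.commute)
      have "Q * k2 \<le> ?I + 3 * Z"
        using minor_integral_ge_Q unfolding k2_def by simp
      also have "\<dots> \<le> ?I * (1 + 3 / k1)" using Z by (simp add: algebra_simps)
      finally have "Q \<le> ?I * (1 + 3 / k1) / k2" using k by (simp add: pos_le_divide_eq)
      moreover have "real N * ln u \<le> 2 * Z"
      proof -
        \<comment> \<open>Since \<open>u - 1 = ln M / ln y\<close>, this elementary inequality
          converts \<open>N * ln u\<close> into a multiple of \<open>Z\<close>.\<close>
        have "ln u \<le> u - 1" using u1 by (intro ln_le_minus_one) simp
        also have "\<dots> = ln M / ln y" unfolding lnM' using lny by simp
        also have "\<dots> \<le> ln M / (L / 2)" using lny2 lnM_ge L by (intro divide_left_mono) auto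
        finally have "real N * ln u \<le> real N * (ln M / (L / 2))" by (intro mult_left_mono) auto
        then show ?thesis by (simp add: Z_def mult_ac)
      qed
      ultimately have "real N * ln u + Q \<le> 2 * (?I / k1) + ?I * (1 + 3 / k1) / k2" using Z by linarith
      also have "\<dots> = D * ?I" by (simp add: D_def algebra_simps)
      finally show ?thesis using D by (simp add: pos_divide_le_eq mult.commute)
    qed
    show "\<exists>C>0. \<exists>\<kappa>>0. \<exists>N\<^sub>0::nat. \<forall>N\<ge>N\<^sub>0. \<forall>(Q::real) (Q\<^sub>0::real) (y::real) (u::real).
       real N powr (1/2 + \<delta>) \<le> Q \<and>
       K * sqrt (real N * ln (real N)) \<le> Q \<and> Q \<le> real N \<and>
       real N * ln (real N) / Q \<le> Q\<^sub>0 \<and> Q\<^sub>0 \<le> Q / K\<^sup>2 \<and>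
       K * Q\<^sub>0 \<le> real N powr (1/2 - \<delta>) * ln (real N) ^ 17 \<and>
       0 < y \<and> u = ln (real N) / ln y \<and>
       1 + ln C / ln (real N) \<le> u \<and> u \<le> 2
       \<longrightarrow> (LINT \<theta>:minor_arcs K Q\<^sub>0 Q|lborel.
              (cmod (exp_sum (indicator (smooth_numbers y)) N \<theta>))\<^sup>2)
           \<ge> \<kappa> * (real N * ln u + Q)"
      by (rule exI[of _ C], rule conjI, simp add: C_def, rule exI[of _ "1 / D"], rule conjI,
          simp add: D, rule exI[of _ N\<^sub>0], blast intro: main)
  qed
qed

end
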